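(* $\displaystyle\sum_{n\ge0}|\mathrm{VHC}(\operatorname{Av}_n(231,1243))|x^n=1+\frac{2x^2}{3x-1+\sqrt{1-2x-3x^2}}.$
   Context: $S_n$ is the set of permutations of $[n]$ ($S_0$ contains only the empty permutation); $\operatorname{Av}_n(231,1243)$ is the set of $\pi\in S_n$ having no subsequence in the same relative order as $231$ or as $1243$. Valid hook configurations. For $\pi=\pi_1\cdots\pi_n$, a descent is $i\in[n-1]$ with $\pi_i>\pi_{i+1}$, and $(i,\pi_i)$ is a descent top of the plot $\{(i,\pi_i)\}$. A hook is determined by $i<j$ with $\pi_i<\pi_j$: vertical segment from $(i,\pi_i)$ up to $(i,\pi_j)$, then horizontal segment to $(j,\pi_j)$; southwest endpoint $(i,\pi_i)$, northeast endpoint $(j,\pi_j)$. If $\pi$ has descents $d_1<\cdots<d_k$, a valid hook configuration is a tuple $(H_1,\dots,H_k)$ of hooks such that (1) $H_i$ has southwest endpoint $(d_i,\pi_{d_i})$; (2) no point of the plot lies directly above a hook; (3) hooks do not intersect or overlap except that the northeast endpoint of one may be the southwest endpoint of another. $\mathrm{VHC}(\pi)$ is the set of these (configurations of distinct permutations are distinct; an increasing permutation, including the empty one, has exactly one, with no hooks); $\mathrm{VHC}(A)=\bigcup_{\pi\in A}\mathrm{VHC}(\pi)$. *)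

theory Defs
  imports
    Complex_Main
    "HOL-Library.Sublist"
    "HOL-Combinatorics.Multiset_Permutations"
    "HOL-Computational_Algebra.Formal_Power_Series"
begin

(* Permutations of [n] are lists in one-line notation, i.e. elements of
   permutations_of_set {1..n}.  List positions are counted from 0, so every plot is
   translated one unit to the left. *)

definition same_relative_order :: "nat list \<Rightarrow> nat list \<Rightarrow> bool" where
  "same_relative_order xs ys \<longleftrightarrow>
     length xs = length ys \<and>
     (\<forall>i < length xs. \<forall>j < length xs. xs ! i < xs ! j \<longleftrightarrow> ys ! i < ys ! j)"

definition contains_pattern :: "nat list \<Rightarrow> nat list \<Rightarrow> bool" where
  "contains_pattern \<pi> \<tau> \<longleftrightarrow> (\<exists>\<sigma>. subseq \<sigma> \<pi> \<and> same_relative_order \<sigma> \<tau>)"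

definition Av :: "nat \<Rightarrow> nat list set \<Rightarrow> nat list set" where
  "Av n T = {\<pi> \<in> permutations_of_set {1..n}. \<forall>\<tau> \<in> T. \<not> contains_pattern \<pi> \<tau>}"

definition descents :: "nat list \<Rightarrow> nat set" where
  "descents \<pi> = {i. Suc i < length \<pi> \<and> \<pi> ! i > \<pi> ! Suc i}"

definition plot_point :: "nat list \<Rightarrow> nat \<Rightarrow> real \<times> real" where
  "plot_point \<pi> i = (real i, real (\<pi> ! i))"

(* A hook is stored as the pair (i, j) of positions of its southwest and northeast
   endpoints; hook_region is the hook itself, as a set of points of the plane. *)

type_synonym hook = "nat \<times> nat"

definition is_hook :: "nat list \<Rightarrow> hook \<Rightarrow> bool" where
  "is_hook \<pi> = (\<lambda>(i, j). i < j \<and> j < length \<pi> \<and> \<pi> ! i < \<pi> ! j)"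

definition southwest :: "nat list \<Rightarrow> hook \<Rightarrow> real \<times> real" where
  "southwest \<pi> h = plot_point \<pi> (fst h)"

definition northeast :: "nat list \<Rightarrow> hook \<Rightarrow> real \<times> real" where
  "northeast \<pi> h = plot_point \<pi> (snd h)"

definition hook_region :: "nat list \<Rightarrow> hook \<Rightarrow> (real \<times> real) set" where
  "hook_region \<pi> = (\<lambda>(i, j).
     {real i} \<times> {real (\<pi> ! i)..real (\<pi> ! j)} \<union>
     {real i..real j} \<times> {real (\<pi> ! j)})"

definition lies_directly_above :: "real \<times> real \<Rightarrow> (real \<times> real) set \<Rightarrow> bool" where
  "lies_directly_above p S \<longleftrightarrow> (\<exists>y. (fst p, y) \<in> S \<and> y < snd p)"

definition valid_hook_configuration :: "nat list \<Rightarrow> hook list \<Rightarrow> bool" where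
  "valid_hook_configuration \<pi> H \<longleftrightarrow>
     (\<forall>h \<in> set H. is_hook \<pi> h) \<and>
     map fst H = sorted_list_of_set (descents \<pi>) \<and>
     (\<forall>h \<in> set H. \<forall>l < length \<pi>. \<not> lies_directly_above (plot_point \<pi> l) (hook_region \<pi> h)) \<and>
     (\<forall>a < length H. \<forall>b < length H. a \<noteq> b \<longrightarrow>
        (\<forall>p \<in> hook_region \<pi> (H ! a) \<inter> hook_region \<pi> (H ! b).
           p = northeast \<pi> (H ! a) \<and> p = southwest \<pi> (H ! b) \<or>
           p = northeast \<pi> (H ! b) \<and> p = southwest \<pi> (H ! a)))"

(* Pairing with the permutation makes configurations of distinct permutations distinct,
   even though hooks are stored by positions only. *)

definition VHC :: "nat list \<Rightarrow> (nat list \<times> hook list) set" where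
  "VHC \<pi> = {(\<pi>, H) | H. valid_hook_configuration \<pi> H}"

definition VHC_set :: "nat list set \<Rightarrow> (nat list \<times> hook list) set" where
  "VHC_set A = (\<Union>\<pi>\<in>A. VHC \<pi>)"

end

theory Submission
  imports Defs
begin

text \<open>Allow descents without a hook, called open, and read a permutation from left to right.  A new
  maximum at the end either leaves a configuration unchanged or receives a hook from the rightmost
  open descent, while a maximum in front of a nonempty word is a new open descent.

  Let \<open>D\<^sub>t\<close> and \<open>B\<^sub>t\<close> be the generating functions, by size, of the configurations with \<open>t\<close> open
  descents on the nonempty permutations that avoid 231 and 132, respectively 231 and 1243.  In the
  first class the maximum is first or last.  In the second class it can also be in the middle; then
  avoiding 231 puts the values to its left below those to its right, and avoiding 1243 forces
  the left part to be decreasing and the right part to avoid 132.  A decreasing word of length \<open>k\<close>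
  followed by a maximum has one configuration with \<open>k - 1\<close> open descents and, if \<open>k \<ge> 2\<close>, one with
  \<open>k - 2\<close>.  Hence, for \<open>D\<^sub>-\<^sub>1 = B\<^sub>-\<^sub>1 = 0\<close>,
  \<open>D\<^sub>t = [t = 0] x + x (D\<^sub>t\<^sub>-\<^sub>1 + D\<^sub>t + D\<^sub>t\<^sub>+\<^sub>1)\<close> and
  \<open>B\<^sub>t = [t = 0] x + x (B\<^sub>t\<^sub>-\<^sub>1 + B\<^sub>t + B\<^sub>t\<^sub>+\<^sub>1) + (\<Sum>i<t. (x^(i+2) + x^(i+3)) D\<^sub>t\<^sub>-\<^sub>1\<^sub>-\<^sub>i)\<close>.
  With the series \<open>u = x (1 + u + u^2)\<close> the solution is \<open>D\<^sub>t = u^(t+1)\<close> and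
  \<open>(1 - u) (1 + u) B\<^sub>t = (t + 1) x (1 + u) u^t - (1 - u) (u^t - x^t)\<close>, so \<open>B\<^sub>0 = x / (1 - u)\<close>, and
  \<open>u\<close> is a root of a quadratic equation.\<close>

unbundle fps_syntax

section \<open>Hook configurations with open descents\<close>

text \<open>A discrete form of the geometric definition in which some descents may have no hook (they
  are called open).  Under a hook from \<open>i\<close> to \<open>j\<close> every descent has a hook that ends before \<open>j\<close>;
  this expresses non-crossing and also forbids open descents under a hook.\<close>

definition hook_cfg :: "nat list \<Rightarrow> hook set \<Rightarrow> bool" where
  "hook_cfg w F \<longleftrightarrow>
     (\<forall>i j. (i, j) \<in> F \<longrightarrow> i \<in> descents w \<and> i < j \<and> j < length w \<and>
        (\<forall>l. i \<le> l \<and> l < j \<longrightarrow> w ! l < w ! j) \<and>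
        (\<forall>i'\<in>descents w. i < i' \<and> i' < j \<longrightarrow> (\<exists>j'<j. (i', j') \<in> F))) \<and>
     (\<forall>i j j'. (i, j) \<in> F \<longrightarrow> (i, j') \<in> F \<longrightarrow> j = j')"

definition open_descents :: "nat list \<Rightarrow> hook set \<Rightarrow> nat set" where
  "open_descents w F = descents w - fst ` F"

text \<open>For \<open>t = 0\<close> these are the valid hook configurations, by
  \<open>bij_betw_VHC_cfgs\<close>. Positive \<open>t\<close> arises because deleting a last maximum
  may also delete a hook.\<close>

definition cfgs :: "nat list \<Rightarrow> nat \<Rightarrow> hook set set" where
  "cfgs w t = {F. hook_cfg w F \<and> card (open_descents w F) = t}"

lemma hook_cfgD:
  assumes "hook_cfg w F" "(i, j) \<in> F"
  shows "i \<in> descents w" "i < j" "j < length w"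
    "\<And>l. i \<le> l \<Longrightarrow> l < j \<Longrightarrow> w ! l < w ! j"
    "\<And>i'. i' \<in> descents w \<Longrightarrow> i < i' \<Longrightarrow> i' < j \<Longrightarrow> \<exists>j'<j. (i', j') \<in> F"
    "\<And>j'. (i, j') \<in> F \<Longrightarrow> j' = j"
  using assms unfolding hook_cfg_def by blast+

lemma hook_cfgI:
  assumes "\<And>i j. (i, j) \<in> F \<Longrightarrow> i \<in> descents w"
    and "\<And>i j. (i, j) \<in> F \<Longrightarrow> i < j"
    and "\<And>i j. (i, j) \<in> F \<Longrightarrow> j < length w"
    and "\<And>i j l. (i, j) \<in> F \<Longrightarrow> i \<le> l \<Longrightarrow> l < j \<Longrightarrow> w ! l < w ! j"
    and "\<And>i j i'. (i, j) \<in> F \<Longrightarrow> i' \<in> descents w \<Longrightarrow> i < i' \<Longrightarrow> i' < j \<Longrightarrow> \<exists>j'<j. (i', j') \<in> F"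
    and "\<And>i j j'. (i, j) \<in> F \<Longrightarrow> (i, j') \<in> F \<Longrightarrow> j = j'"
  shows "hook_cfg w F"
  unfolding hook_cfg_def using assms by blast

lemma finite_descents [simp]: "finite (descents w)"
  by (rule finite_subset[of _ "{..<length w}"]) (auto simp: descents_def)

lemma finite_open_descents [simp]: "finite (open_descents w F)"
  by (simp add: open_descents_def)

lemma finite_cfgs [simp]: "finite (cfgs w t)"
proof (rule finite_subset)
  show "cfgs w t \<subseteq> Pow ({..<length w} \<times> {..<length w})"
    unfolding cfgs_def using hook_cfgD(2,3) by fastforce
qed auto

text \<open>Of two hooks with the same end, the left one would lie over the start of the right one,
  whose hook would then have to end strictly earlier.\<close>

lemma hook_cfg_NE_unique:
  assumes "hook_cfg w F" "(i, j) \<in> F" "(i', j) \<in> F"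
  shows "i = i'"
proof -
  have *: "\<not> a < b" if "(a, j) \<in> F" "(b, j) \<in> F" for a b
    using hook_cfgD[OF assms(1) that(1)] hook_cfgD[OF assms(1) that(2)] by blast
  show ?thesis using *[OF assms(2,3)] *[OF assms(3,2)] by simp
qed

section \<open>Appending a new maximum\<close>

lemma descents_snoc_greater:
  assumes "\<forall>x\<in>set w. x < m"
  shows "descents (w @ [m]) = descents w"
proof -
  have "\<not> m < w ! i" if "i < length w" for i
    using assms that by (meson nth_mem not_less_iff_gr_or_eq)
  then show ?thesis
    by (auto simp: descents_def nth_append less_Suc_eq)
qed

text \<open>The nesting condition of a hook asks only for hooks that end earlier, so it survives the
  removal of a hook ending at the last position.\<close>

lemma hook_cfg_butlast:
  assumes "hook_cfg (w @ [m]) F" "\<forall>x\<in>set w. x < m"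
  shows "hook_cfg w {(i, j) \<in> F. j < length w}"
proof -
  note D = hook_cfgD[OF assms(1)]
  note d = descents_snoc_greater[OF assms(2)]
  show ?thesis
  proof (rule hook_cfgI, goal_cases)
    case (4 i j l)
    then show ?case using D(4)[of i j l] by (auto simp: nth_append)
  next
    case (5 i j i')
    then show ?case using D(5)[of i j i'] d by (auto)
  qed (use D d in auto)
qed

lemma hook_cfg_snoc:
  assumes "hook_cfg w F" "\<forall>x\<in>set w. x < m"
  shows "hook_cfg (w @ [m]) F"
proof -
  note D = hook_cfgD[OF assms(1)]
  note d = descents_snoc_greater[OF assms(2)]
  show ?thesis
  proof (rule hook_cfgI, goal_cases)
    case (3 i j)
    then show ?case using D(3)[of i j] by auto
  next
    case (4 i j l)
    then show ?case using D(3,4)[of i j] by (auto simp: nth_append)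
  qed (use D d in auto)
qed

lemma open_descents_snoc:
  assumes "\<forall>x\<in>set w. x < m"
  shows "open_descents (w @ [m]) F = open_descents w F"
  by (simp add: open_descents_def descents_snoc_greater[OF assms])

text \<open>Every descent to the right of the rightmost open descent \<open>d\<close> has a hook
  inside \<open>w\<close>, and \<open>m\<close> exceeds all letters, so a hook from \<open>d\<close>
  to \<open>m\<close> is allowed.\<close>

lemma hook_cfg_snoc_close:
  assumes "hook_cfg w F" "\<forall>x\<in>set w. x < m" "open_descents w F \<noteq> {}"
  defines "d \<equiv> Max (open_descents w F)"
  shows "hook_cfg (w @ [m]) (insert (d, length w) F)"
    and "open_descents w (insert (d, length w) F) = open_descents w F - {d}"
    and "d \<in> open_descents w F"
proof -
  note D = hook_cfgD[OF assms(1)]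
  note de = descents_snoc_greater[OF assms(2)]
  show d_in: "d \<in> open_descents w F" unfolding d_def by (intro Max_in assms) simp
  have d_max: "e \<le> d" if "e \<in> open_descents w F" for e unfolding d_def using that by simp
  have d1: "d \<in> descents w" "\<And>j. (d, j) \<notin> F" using d_in by (force simp: open_descents_def)+
  have dl: "d < length w" using d1 by (simp add: descents_def)
  show "hook_cfg (w @ [m]) (insert (d, length w) F)"
  proof (rule hook_cfgI, goal_cases)
    case (1 i j)
    then show ?case using D(1)[of i j] de d1 by auto
  next
    case (2 i j)
    then show ?case using D(2)[of i j] dl by auto
  next
    case (3 i j)
    then show ?case using D(3)[of i j] by auto
  next
    case (4 i j l)
    then show ?case using D(3,4)[of i j] assms(2) by (auto simp: nth_append)
  next
    case (5 i j i')
    show ?case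
    proof (cases "(i, j) \<in> F")
      case True
      then show ?thesis using D(5)[of i j i'] 5 de by auto
    next
      case False
      then have "i = d" "j = length w" using 5 by auto
      moreover have "i' \<notin> open_descents w F" using d_max[of i'] 5 \<open>i = d\<close> by auto
      ultimately obtain j' where "(i', j') \<in> F"
        using 5 de by (force simp: open_descents_def)
      then show ?thesis using D(3) \<open>j = length w\<close> by blast
    qed
  next
    case (6 i j j')
    then show ?case using D(6) d1 by auto
  qed
  show "open_descents w (insert (d, length w) F) = open_descents w F - {d}"
    by (auto simp: open_descents_def)
qed

text \<open>Converse of \<open>hook_cfg_snoc_close\<close>: only one hook ends at the new maximum,
  and its start is determined by the other hooks.\<close>

lemma hook_cfg_snoc_cases:
  assumes "hook_cfg (w @ [m]) F" "\<forall>x\<in>set w. x < m" "(d, length w) \<in> F"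
  defines "F' \<equiv> {(i, j) \<in> F. j < length w}"
  shows "F = insert (d, length w) F'" "d = Max (open_descents w F')" "open_descents w F' \<noteq> {}"
proof -
  note D = hook_cfgD[OF assms(1)]
  note de = descents_snoc_greater[OF assms(2)]
  show F: "F = insert (d, length w) F'"
  proof (intro set_eqI iffI)
    fix p assume "p \<in> F"
    then obtain i j where p: "p = (i, j)" "(i, j) \<in> F" by (cases p) auto
    then have "j = length w \<or> j < length w" using D(3)[of i j] by auto
    then show "p \<in> insert (d, length w) F'"
      using p hook_cfg_NE_unique[OF assms(1,3)] by (auto simp: F'_def)
  next
    fix p assume "p \<in> insert (d, length w) F'"
    then show "p \<in> F" using assms(3) by (auto simp: F'_def)
  qed
  have d_in: "d \<in> open_descents w F'"
    using D(1,6)[OF assms(3)] de by (fastforce simp: open_descents_def F'_def)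
  then show "open_descents w F' \<noteq> {}" by blast
  have "e \<le> d" if e: "e \<in> open_descents w F'" for e
  proof (rule ccontr)
    assume "\<not> e \<le> d"
    moreover have "e \<in> descents (w @ [m])" "e < length w"
      using e de by (auto simp: open_descents_def descents_def)
    ultimately obtain j' where "j' < length w" "(e, j') \<in> F"
      using D(5)[OF assms(3), of e] by auto
    then show False using e by (force simp: open_descents_def F'_def)
  qed
  then show "d = Max (open_descents w F')"
    using d_in by (intro Max_eqI[symmetric]) auto
qed

text \<open>A hook that ends at a new last maximum has to start at the rightmost open descent: all
  descents between its endpoints have hooks that end earlier.\<close>

lemma card_cfgs_snoc:
  assumes "\<forall>x\<in>set w. x < m"
  shows "card (cfgs (w @ [m]) t) = card (cfgs w t) + card (cfgs w (Suc t))"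
proof -
  \<comment> \<open>\<open>g\<close> closes the rightmost open descent. Keeping only the hooks that
    end inside \<open>w\<close> undoes this, which gives injectivity.\<close>
  define g where "g F = insert (Max (open_descents w F), length w) F" for F
  have lt: "j < length w" if "F \<in> cfgs w s" "(i, j) \<in> F" for F s i j
    using that hook_cfgD(3) by (auto simp: cfgs_def)
  have g: "F = {(i, j) \<in> g F. j < length w}" if "F \<in> cfgs w s" for F s
    using lt[OF that] by (auto simp: g_def)
  have inj: "inj_on g (cfgs w (Suc t))"
  proof (rule inj_onI)
    fix F F' assume *: "F \<in> cfgs w (Suc t)" "F' \<in> cfgs w (Suc t)" "g F = g F'"
    show "F = F'" using g[OF *(1)] g[OF *(2)] *(3) by simp
  qed
  have disj: "cfgs w t \<inter> g ` cfgs w (Suc t) = {}"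
    using lt[of _ t] by (force simp: g_def)
  have "cfgs (w @ [m]) t = cfgs w t \<union> g ` cfgs w (Suc t)"
  proof (intro set_eqI iffI)
    fix F assume F: "F \<in> cfgs (w @ [m]) t"
    define F' where "F' = {(i, j) \<in> F. j < length w}"
    have c: "hook_cfg (w @ [m]) F" "card (open_descents w F) = t"
      using F assms by (auto simp: cfgs_def open_descents_snoc)
    have c': "hook_cfg w F'"
      unfolding F'_def by (rule hook_cfg_butlast[OF c(1) assms])
    show "F \<in> cfgs w t \<union> g ` cfgs w (Suc t)"
    \<comment> \<open>Either no hook ends at \<open>m\<close> and \<open>F\<close> already lives on
      \<open>w\<close>, or exactly one does and \<open>F\<close> lies in the image of
      \<open>g\<close>.\<close>
    proof (cases "\<exists>d. (d, length w) \<in> F")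
      case False
      have "F = F'"
      proof (intro set_eqI iffI)
        fix p assume "p \<in> F"
        then show "p \<in> F'"
          using False hook_cfgD(3)[OF c(1), of "fst p" "snd p"]
          by (cases p) (auto simp: F'_def less_Suc_eq)
      qed (auto simp: F'_def)
      then show ?thesis using c c' by (auto simp: cfgs_def)
    next
      case True
      then obtain d where "(d, length w) \<in> F" by blast
      note s = hook_cfg_snoc_cases[OF c(1) assms this, folded F'_def]
      have Fg: "F = g F'" using s(1,2) by (simp add: g_def)
      note s' = hook_cfg_snoc_close[OF c' assms s(3)]
      have "open_descents w F = open_descents w F' - {Max (open_descents w F')}"
        using s'(2) s(1,2) by simp
      then have "card (open_descents w F') = Suc t"
        using s'(3) c(2) by (metis card.remove finite_open_descents)
      then show ?thesis using Fg c' by (auto simp: cfgs_def)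
    qed
  next
    fix F assume "F \<in> cfgs w t \<union> g ` cfgs w (Suc t)"
    then show "F \<in> cfgs (w @ [m]) t"
    proof
      assume "F \<in> cfgs w t"
      then show ?thesis using hook_cfg_snoc assms by (auto simp: cfgs_def open_descents_snoc)
    next
      assume "F \<in> g ` cfgs w (Suc t)"
      then obtain F' where F': "F = g F'" "hook_cfg w F'" "card (open_descents w F') = Suc t"
        by (auto simp: cfgs_def)
      have "open_descents w F' \<noteq> {}" using F'(3) by force
      note s' = hook_cfg_snoc_close[OF F'(2) assms this]
      show ?thesis using s' F' by (simp add: cfgs_def g_def open_descents_snoc[OF assms])
    qed
  qed
  then show ?thesis
    using disj inj by (simp add: card_Un_disjoint card_image)
qed

lemma cfgs_short:
  assumes "length w \<le> 1"
  shows "cfgs w t = (if t = 0 then {{}} else {})"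
proof -
  have "descents w = {}" using assms by (auto simp: descents_def)
  then show ?thesis by (auto simp: cfgs_def hook_cfg_def open_descents_def)
qed

text \<open>Hook conditions only compare values. This is applied to right factors whose values are
  shifted up by a constant.\<close>

lemma cfgs_map_strict_mono:
  assumes "strict_mono f"
  shows "cfgs (map f w) t = cfgs w t"
proof -
  have d: "descents (map f w) = descents w"
    by (auto simp: descents_def strict_mono_less[OF assms])
  have "hook_cfg (map f w) F \<longleftrightarrow> hook_cfg w F" for F
  proof
    assume *: "hook_cfg (map f w) F"
    note D = hook_cfgD[OF *]
    show "hook_cfg w F"
    proof (rule hook_cfgI, goal_cases)
      case (4 i j l)
      then show ?case using D(3,4)[of i j] by (auto simp: strict_mono_less[OF assms])
    qed (use D d in auto)
  next
    assume *: "hook_cfg w F"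
    note D = hook_cfgD[OF *]
    show "hook_cfg (map f w) F"
    proof (rule hook_cfgI, goal_cases)
      case (4 i j l)
      then show ?case using D(3,4)[of i j] by (auto simp: strict_mono_less[OF assms])
    qed (use D d in auto)
  qed
  then show ?thesis by (simp add: cfgs_def open_descents_def d)
qed

section \<open>Splitting a word after its maximum\<close>

definition shift_cfg :: "nat \<Rightarrow> hook set \<Rightarrow> hook set" where
  "shift_cfg n F = (\<lambda>(i, j). (i + n, j + n)) ` F"

lemma in_shift_cfg: "(a, b) \<in> shift_cfg n F \<longleftrightarrow> n \<le> a \<and> n \<le> b \<and> (a - n, b - n) \<in> F"
  by (force simp: shift_cfg_def image_iff)

text \<open>The last letter of \<open>u\<close> is the strict maximum of \<open>u @ v\<close>. No
  hook can pass it or start at it, so configurations of \<open>u @ v\<close> are pairs of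
  configurations of the factors.\<close>

context
  fixes u v :: "nat list"
  assumes ne: "u \<noteq> []" "v \<noteq> []"
    and top: "\<forall>x\<in>set (butlast u) \<union> set v. x < last u"
begin

lemma add_length_neq_last_index: "i + length u \<noteq> length u - Suc 0" "length u \<noteq> length u - Suc 0"
  using ne by (cases u; simp)+

lemma nth_less_nth_last:
  assumes "l < length (u @ v)" "l \<noteq> length u - 1"
  shows "(u @ v) ! l < (u @ v) ! (length u - 1)"
proof -
  have e: "(u @ v) ! (length u - 1) = last u" using ne by (simp add: nth_append last_conv_nth)
  show ?thesis
  proof (cases "l < length u")
    case True
    then have "l < length (butlast u)" using assms by auto
    then have "u ! l \<in> set (butlast u)" by (metis nth_butlast nth_mem)
    then show ?thesis using top e True by (auto simp: nth_append)
  next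
    case False
    then have "v ! (l - length u) \<in> set v" using assms(1) by auto
    then show ?thesis using top e False by (simp add: nth_append)
  qed
qed

lemma descents_append:
  "descents (u @ v) = descents u \<union> {length u - 1} \<union> (\<lambda>i. i + length u) ` descents v"
proof (intro set_eqI iffI)
  fix i assume i: "i \<in> descents (u @ v)"
  consider "Suc i < length u" | "Suc i = length u" | "length u \<le> i" by linarith
  then show "i \<in> descents u \<union> {length u - 1} \<union> (\<lambda>i. i + length u) ` descents v"
  proof cases
    case 3
    then have "i - length u \<in> descents v"
      using i by (auto simp: descents_def nth_append Suc_diff_le)
    then show ?thesis using 3 by (force simp: image_iff)
  qed (use i in \<open>auto simp: descents_def nth_append\<close>)
next
  fix i assume "i \<in> descents u \<union> {length u - 1} \<union> (\<lambda>i. i + length u) ` descents v"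
  then consider "i \<in> descents u" | "i = length u - 1" | k where "k \<in> descents v" "i = k + length u"
    by blast
  then show "i \<in> descents (u @ v)"
  proof cases
    case 2
    moreover have "Suc i = length u" "length v > 0" using 2 ne by auto
    ultimately show ?thesis using nth_less_nth_last[of "length u"] add_length_neq_last_index(2) by (auto simp: descents_def)
  qed (auto simp: descents_def nth_append)
qed

lemma descent_less_last_index: "i \<in> descents u \<Longrightarrow> i < length u - 1"
  by (auto simp: descents_def)

text \<open>A hook of \<open>u\<close> ends at the maximum or before it and a hook of
  \<open>v\<close> starts after it, so the descents under a hook belong to its own factor.\<close>

lemma hook_cfg_append_join:
  assumes "hook_cfg u F" "hook_cfg v G"
  shows "hook_cfg (u @ v) (F \<union> shift_cfg (length u) G)"
proof -
  note D = hook_cfgD[OF assms(1)]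
  note E = hook_cfgD[OF assms(2)]
  have lt: "i < length u" "j < length u" if "(i, j) \<in> F" for i j
    using D(2,3)[OF that] by auto
  show ?thesis
  proof (rule hook_cfgI, goal_cases)
    case (1 i j)
    then show ?case using D(1)[of i j] E(1)[of "i - length u" "j - length u"]
      by (force simp: descents_append in_shift_cfg image_iff)
  next
    case (2 i j)
    then show ?case using D(2)[of i j] E(2)[of "i - length u" "j - length u"]
      by (auto simp: in_shift_cfg)
  next
    case (3 i j)
    then show ?case using D(3)[of i j] E(3)[of "i - length u" "j - length u"]
      by (auto simp: in_shift_cfg)
  next
    case (4 i j l)
    then show ?case using D(3,4)[of i j] E(4)[of "i - length u" "j - length u" "l - length u"]
      by (auto simp: in_shift_cfg nth_append)
  next
    case (5 i j i')
    show ?case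
    proof (cases "(i, j) \<in> F")
      case True
      then have "i' \<in> descents u" using 5 lt[OF True] by (auto simp: descents_append)
      then show ?thesis using D(5)[OF True] 5 by auto
    next
      case False
      then have *: "length u \<le> i" "(i - length u, j - length u) \<in> G" "length u \<le> j"
        using 5 by (auto simp: in_shift_cfg)
      then obtain k where k: "k \<in> descents v" "i' = k + length u"
        using 5 ne descent_less_last_index[of i'] by (auto simp: descents_append)
      have "i - length u < k" "k < j - length u" using 5 k * by linarith+
      then obtain j' where "j' < j - length u" "(k, j') \<in> G"
        using E(5)[OF *(2) k(1)] by blast
      then show ?thesis using k by (intro exI[of _ "j' + length u"]) (auto simp: in_shift_cfg)
    qed
  next
    case (6 i j j')
    show ?case
    proof (cases "i < length u")
      case True
      then show ?thesis using 6 D(6) by (auto simp: in_shift_cfg)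
    next
      case False
      then have "(i - length u, j - length u) \<in> G" "(i - length u, j' - length u) \<in> G"
        "length u \<le> j" "length u \<le> j'"
        using 6 lt by (auto simp: in_shift_cfg)
      then show ?thesis using E(6) by (metis le_add_diff_inverse)
    qed
  qed
qed

lemma hook_cfg_append_split:
  assumes "hook_cfg (u @ v) F"
  defines "F1 \<equiv> {(i, j) \<in> F. j < length u}"
    and "F2 \<equiv> {(i, j). (i + length u, j + length u) \<in> F}"
  shows "hook_cfg u F1" "hook_cfg v F2" "F = F1 \<union> shift_cfg (length u) F2"
proof -
  note D = hook_cfgD[OF assms(1)]
  \<comment> \<open>A hook starting at or before the maximum and ending after it would need an end
    that is higher than the maximum.\<close>
  have split: "j < length u \<or> length u \<le> i" if "(i, j) \<in> F" for i j
  proof (rule ccontr)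
    assume c: "\<not> ?thesis"
    then have "(u @ v) ! (length u - 1) < (u @ v) ! j"
      using D(4)[OF that, of "length u - 1"] ne by auto
    moreover have "(u @ v) ! j < (u @ v) ! (length u - 1)"
      using D(3)[OF that] c ne by (intro nth_less_nth_last) (auto simp: neq_Nil_conv)
    ultimately show False by simp
  qed
  show "hook_cfg u F1"
  proof (rule hook_cfgI, goal_cases)
    case (1 i j)
    then have "i \<in> descents (u @ v)" "i < j" "j < length u" using D(1,2) by (auto simp: F1_def)
    then show ?case by (auto simp: descents_append)
  next
    case (4 i j l)
    then show ?case using D(4)[of i j l] by (auto simp: F1_def nth_append)
  next
    case (5 i j i')
    then have "i' \<in> descents (u @ v)" by (simp add: descents_append)
    then show ?case using D(5)[of i j i'] 5 by (auto simp: F1_def)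
  qed (use D in \<open>auto simp: F1_def\<close>)
  show "hook_cfg v F2"
  proof (rule hook_cfgI, goal_cases)
    case (1 i j)
    then have "i + length u \<in> descents (u @ v)" using D(1) by (auto simp: F2_def)
    then show ?case using add_length_neq_last_index(1)[of i] descent_less_last_index[of "i + length u"] by (auto simp: descents_append)
  next
    case (2 i j)
    then show ?case using D(2)[of "i + length u" "j + length u"] by (auto simp: F2_def)
  next
    case (3 i j)
    then show ?case using D(3)[of "i + length u" "j + length u"] by (auto simp: F2_def)
  next
    case (4 i j l)
    then show ?case using D(4)[of "i + length u" "j + length u" "l + length u"]
      by (auto simp: F2_def nth_append)
  next
    case (5 i j i')
    then have d: "i' + length u \<in> descents (u @ v)" by (simp add: descents_append)
    obtain j' where j': "j' < j + length u" "(i' + length u, j') \<in> F"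
      using D(5)[OF _ d, of "i + length u" "j + length u"] 5 by (auto simp: F2_def)
    moreover have "length u \<le> j'" using D(2)[OF j'(2)] by simp
    ultimately show ?case by (intro exI[of _ "j' - length u"]) (auto simp: F2_def)
  next
    case (6 i j j')
    then show ?case using D(6)[of "i + length u" "j + length u" "j' + length u"] by (auto simp: F2_def)
  qed
  show "F = F1 \<union> shift_cfg (length u) F2"
    using split D(2) by (fastforce simp: F1_def F2_def in_shift_cfg)
qed

text \<open>The additional open descent is the maximum itself, at position
  \<open>length u - 1\<close>.\<close>

lemma card_open_descents_append:
  assumes "hook_cfg u F" "hook_cfg v G"
  shows "card (open_descents (u @ v) (F \<union> shift_cfg (length u) G)) =
    Suc (card (open_descents u F) + card (open_descents v G))"
proof -
  let ?n = "length u"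
  have n: "?n > 0" using ne by simp
  have F: "fst ` F \<subseteq> {..<?n - 1}" using hook_cfgD(1)[OF assms(1)] descent_less_last_index by fastforce
  have G: "fst ` shift_cfg ?n G = (\<lambda>i. i + ?n) ` fst ` G"
    by (force simp: shift_cfg_def image_iff)
  have "open_descents (u @ v) (F \<union> shift_cfg ?n G) =
    insert (?n - 1) (open_descents u F \<union> (\<lambda>i. i + ?n) ` open_descents v G)" (is "?L = insert _ (?A \<union> ?B)")
  proof (intro set_eqI iffI)
    fix i assume "i \<in> ?L"
    then show "i \<in> insert (?n - 1) (?A \<union> ?B)"
      by (auto simp: open_descents_def descents_append image_Un G)
  next
    fix i assume i: "i \<in> insert (?n - 1) (?A \<union> ?B)"
    then consider "i = ?n - 1" | "i \<in> ?A" | "i \<in> ?B" by blast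
    then show "i \<in> ?L"
    proof cases
      case 1
      then show ?thesis using F add_length_neq_last_index(1)[symmetric] by (auto simp: open_descents_def descents_append image_Un G)
    next
      case 2
      then show ?thesis using descent_less_last_index[of i]
        by (auto simp: open_descents_def descents_append image_Un G)
    next
      case 3
      then obtain k where k: "i = k + ?n" "k \<in> descents v" "k \<notin> fst ` G"
        by (auto simp: open_descents_def)
      have "i \<notin> fst ` F" using F k(1) by auto
      moreover have "i \<notin> (\<lambda>i. i + ?n) ` fst ` G" using k(1,3) by force
      ultimately show ?thesis using k(1,2)
        unfolding open_descents_def descents_append image_Un G by blast
    qed
  qed
  moreover have "?n - 1 \<notin> ?A \<union> ?B" using add_length_neq_last_index(1)[symmetric] descent_less_last_index[of "?n - 1"] by (auto simp: open_descents_def)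
  moreover have "?A \<inter> ?B = {}" using descent_less_last_index by (fastforce simp: open_descents_def)
  ultimately show ?thesis by (simp add: card_Un_disjoint card_image)
qed

text \<open>The maximum accounts for one open descent; the other \<open>t\<close> are distributed
  over the two factors, which gives a convolution.\<close>

lemma card_cfgs_append:
  "card (cfgs (u @ v) 0) = 0"
  "card (cfgs (u @ v) (Suc t)) = (\<Sum>i\<le>t. card (cfgs u i) * card (cfgs v (t - i)))"
proof -
  define J where "J = (\<lambda>(F, G). F \<union> shift_cfg (length u) G)"
  \<comment> \<open>Both factors can be read off from the positions of the hooks, so
    \<open>J\<close> is injective.\<close>
  have J1: "fst p = {(i, j) \<in> J p. j < length u}" if "hook_cfg u (fst p)" for p
    using hook_cfgD(3)[OF that] by (cases p) (auto simp: J_def in_shift_cfg)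
  have J2: "snd p = {(i, j). (i + length u, j + length u) \<in> J p}" if "hook_cfg u (fst p)" for p
    using hook_cfgD(3)[OF that] by (cases p) (auto simp: J_def in_shift_cfg)
  have inj: "inj_on J {p. hook_cfg u (fst p)}"
  proof (rule inj_onI)
    fix p q assume "p \<in> {p. hook_cfg u (fst p)}" "q \<in> {p. hook_cfg u (fst p)}" "J p = J q"
    then show "p = q" using J1[of p] J1[of q] J2[of p] J2[of q] by (auto intro: prod_eqI)
  qed
  have im: "cfgs (u @ v) s = J ` {p. hook_cfg u (fst p) \<and> hook_cfg v (snd p) \<and>
    Suc (card (open_descents u (fst p)) + card (open_descents v (snd p))) = s}" for s
  proof (intro set_eqI iffI)
    fix F assume F: "F \<in> cfgs (u @ v) s"
    then have c: "hook_cfg (u @ v) F" by (simp add: cfgs_def)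
    note s = hook_cfg_append_split[OF c]
    show "F \<in> J ` {p. hook_cfg u (fst p) \<and> hook_cfg v (snd p) \<and>
      Suc (card (open_descents u (fst p)) + card (open_descents v (snd p))) = s}"
      using s F card_open_descents_append[OF s(1,2)]
      by (intro image_eqI[of _ _ "({(i, j) \<in> F. j < length u}, {(i, j). (i + length u, j + length u) \<in> F})"])
        (auto simp: J_def cfgs_def)
  next
    fix F assume "F \<in> J ` {p. hook_cfg u (fst p) \<and> hook_cfg v (snd p) \<and>
      Suc (card (open_descents u (fst p)) + card (open_descents v (snd p))) = s}"
    then show "F \<in> cfgs (u @ v) s"
      using hook_cfg_append_join card_open_descents_append by (auto simp: J_def cfgs_def)
  qed
  show "card (cfgs (u @ v) 0) = 0" by (simp add: im)
  have "{p. hook_cfg u (fst p) \<and> hook_cfg v (snd p) \<and>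
      Suc (card (open_descents u (fst p)) + card (open_descents v (snd p))) = Suc t}
    = (\<Union>i\<le>t. cfgs u i \<times> cfgs v (t - i))" by (auto simp: cfgs_def)
  then have "cfgs (u @ v) (Suc t) = J ` (\<Union>i\<le>t. cfgs u i \<times> cfgs v (t - i))" by (simp add: im)
  moreover have "inj_on J (\<Union>i\<le>t. cfgs u i \<times> cfgs v (t - i))"
    by (rule inj_on_subset[OF inj]) (auto simp: cfgs_def)
  ultimately have "card (cfgs (u @ v) (Suc t)) = card (\<Union>i\<le>t. cfgs u i \<times> cfgs v (t - i))"
    by (simp add: card_image)
  also have "\<dots> = (\<Sum>i\<le>t. card (cfgs u i \<times> cfgs v (t - i)))"
    by (rule card_UN_disjoint) (simp, simp, auto simp: cfgs_def)
  finally show "card (cfgs (u @ v) (Suc t)) = (\<Sum>i\<le>t. card (cfgs u i) * card (cfgs v (t - i)))"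
    by (simp add: card_cartesian_product)
qed

end

text \<open>The case \<open>u = [m]\<close> of the convolution, since a single letter has only the
  empty configuration.\<close>

lemma card_cfgs_Cons_max:
  assumes "w \<noteq> []" "\<forall>x\<in>set w. x < m"
  shows "card (cfgs (m # w) 0) = 0" "card (cfgs (m # w) (Suc t)) = card (cfgs w t)"
proof -
  have *: "[m] \<noteq> []" "w \<noteq> []" "\<forall>x\<in>set (butlast [m]) \<union> set w. x < last [m]" using assms by auto
  have "card (cfgs [m] i) = (if i = 0 then 1 else 0)" for i by (simp add: cfgs_short)
  then show "card (cfgs (m # w) 0) = 0" "card (cfgs (m # w) (Suc t)) = card (cfgs w t)"
    using card_cfgs_append(1)[OF *] card_cfgs_append(2)[OF *, of t] by (auto simp: if_distrib [of "\<lambda>x. x * _"] cong: if_cong)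
qed

text \<open>A decreasing word admits no hook at all, so all its descents stay open. The induction
  removes the first letter, which is the maximum.\<close>

lemma card_cfgs_decreasing:
  assumes "sorted_wrt (>) w" "w \<noteq> []"
  shows "card (cfgs w t) = (if Suc t = length w then 1 else 0)"
  using assms
proof (induction w arbitrary: t)
  case (Cons m w)
  show ?case
  proof (cases "w = []")
    case True
    then show ?thesis by (simp add: cfgs_short)
  next
    case False
    then show ?thesis using card_cfgs_Cons_max[of w m] Cons by (cases t) auto
  qed
qed simp

section \<open>Valid hook configurations\<close>

text \<open>Condition (2) on points above hooks yields the bound on the heights, condition (3) on
  crossings yields the nesting.\<close>

lemma hook_cfg_of_valid:
  assumes "valid_hook_configuration w H" "distinct w"
  shows "hook_cfg w (set H)"
proof -
  have hook: "i < j" "j < length w" "w ! i < w ! j" if "(i, j) \<in> set H" for i j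
    using assms(1) that by (auto simp: valid_hook_configuration_def is_hook_def)
  have fst: "map fst H = sorted_list_of_set (descents w)"
    using assms(1) by (simp add: valid_hook_configuration_def)
  \<comment> \<open>In each column from \<open>i\<close> to \<open>j\<close> the hook has a point at
    height \<open>w ! j\<close>, so a higher plot point would lie directly above it.\<close>
  have above: "w ! l \<le> w ! j" if "(i, j) \<in> set H" "i \<le> l" "l \<le> j" for i j l
  proof (rule ccontr)
    assume c: "\<not> w ! l \<le> w ! j"
    have "l < length w" using hook(2)[OF that(1)] that(3) by simp
    then have "\<not> lies_directly_above (plot_point w l) (hook_region w (i, j))"
      using assms(1) that(1) by (auto simp: valid_hook_configuration_def)
    moreover have "(real l, real (w ! j)) \<in> hook_region w (i, j)"
      using that by (simp add: hook_region_def)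
    ultimately show False using c by (auto simp: lies_directly_above_def plot_point_def)
  qed
  have cross: "p = northeast w (H ! a) \<and> p = southwest w (H ! b) \<or>
           p = northeast w (H ! b) \<and> p = southwest w (H ! a)"
    if "a < length H" "b < length H" "a \<noteq> b"
      "p \<in> hook_region w (H ! a)" "p \<in> hook_region w (H ! b)" for a b p
    using assms(1) that by (simp add: valid_hook_configuration_def)
  have dist: "distinct (map fst H)" unfolding fst by simp
  have fstset: "fst ` set H = descents w" using fst by (metis finite_descents list.set_map set_sorted_list_of_set)
  show ?thesis
  proof (rule hook_cfgI, goal_cases)
    case (1 i j)
    then show ?case using fstset by force
  next
    case (2 i j)
    then show ?case using hook by blast
  next
    case (3 i j)
    then show ?case using hook by blast
  next
    case (4 i j l)
    then have "w ! l \<noteq> w ! j"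
      using assms(2) hook[OF 4(1)] by (simp add: nth_eq_iff_index_eq)
    then show ?case using above[of i j l] 4 by simp
  next
    case (5 i j i')
    then obtain j' where j': "(i', j') \<in> set H" using fstset by force
    obtain a b where ab: "a < length H" "b < length H" "H ! a = (i, j)" "H ! b = (i', j')"
      using 5(1) j' by (meson in_set_conv_nth)
    then have "a \<noteq> b" using 5 by auto
    have "j' < j"
    proof (rule ccontr)
      assume c: "\<not> j' < j"
      then have le: "w ! j \<le> w ! j'" using above[OF j', of j] 5 by simp
      \<comment> \<open>If the inner hook did not end before \<open>j\<close>, its vertical segment
        would meet the horizontal segment of the outer hook at \<open>p\<close>. The abscissa
        \<open>i'\<close> of \<open>p\<close> is that of neither northeast endpoint.\<close>
      define p where "p = (real i', real (w ! j))"
      have "p \<in> hook_region w (H ! a)" using 5 ab by (auto simp: p_def hook_region_def)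
      moreover have "w ! i' \<le> w ! j" using above[of i j i'] 5 by simp
      then have "p \<in> hook_region w (H ! b)"
        using le ab by (auto simp: p_def hook_region_def)
      ultimately have "p = northeast w (H ! a) \<or> p = northeast w (H ! b)"
        using cross[OF ab(1,2) \<open>a \<noteq> b\<close>] by blast
      then show False
        using 5 hook(1)[OF j'] ab by (auto simp: p_def northeast_def plot_point_def)
    qed
    then show ?case using j' by blast
  next
    case (6 i j j')
    then show ?case using dist by (rule eq_key_imp_eq_value[rotated])
  qed
qed

text \<open>A common point has abscissa at least \<open>i'\<close>, so it lies on the horizontal
  segment of the left hook. If \<open>i' < j\<close>, nesting keeps the right hook strictly below
  that segment; hence the hooks can only touch when \<open>i' = j\<close>.\<close>

lemma hook_regions_meet:
  assumes "hook_cfg w F" "(i, j) \<in> F" "(i', j') \<in> F" "i < i'"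
    and "p \<in> hook_region w (i, j)" "p \<in> hook_region w (i', j')"
  shows "p = northeast w (i, j)" "p = southwest w (i', j')"
proof -
  obtain x y where p: "p = (x, y)" by (cases p)
  have "i' < j'" using hook_cfgD(2)[OF assms(1,3)] .
  have x: "real i' \<le> x" using assms(6) \<open>i' < j'\<close> by (auto simp: p hook_region_def)
  then have y: "y = real (w ! j)" "x \<le> real j"
    using assms(4,5) by (auto simp: p hook_region_def)
  have "\<not> i' < j"
  proof
    assume lt: "i' < j"
    then obtain j'' where "j'' < j" "(i', j'') \<in> F"
      using hook_cfgD(5)[OF assms(1,2) hook_cfgD(1)[OF assms(1,3)] assms(4)] by blast
    then have "j' < j" using hook_cfgD(6)[OF assms(1,3)] by blast
    then have "w ! j' < w ! j"
      using hook_cfgD(4)[OF assms(1,2), of j'] \<open>i' < j'\<close> assms(4) by simp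
    moreover have "y \<le> real (w ! j')" using assms(6) by (auto simp: p hook_region_def)
    ultimately show False using y by simp
  qed
  then have "x = real j" "i' = j" using x y by auto
  then show "p = northeast w (i, j)" "p = southwest w (i', j')"
    using y by (auto simp: p northeast_def southwest_def plot_point_def)
qed

lemma valid_of_hook_cfg:
  assumes "hook_cfg w (set H)" "map fst H = sorted_list_of_set (descents w)"
  shows "valid_hook_configuration w H"
proof -
  note D = hook_cfgD[OF assms(1)]
  have dist: "distinct (map fst H)" unfolding assms(2) by simp
  have hook: "is_hook w h" if "h \<in> set H" for h
    using D(2,3,4)[of "fst h" "snd h"] that by (auto simp: is_hook_def)
  have above: "\<not> lies_directly_above (plot_point w l) (hook_region w h)"
    if "h \<in> set H" for h l
  proof -
    obtain i j where h: "h = (i, j)" by (cases h)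
    have "w ! l \<le> w ! j" if "i \<le> l" "l \<le> j"
      using D(4)[of i j l] that \<open>h \<in> set H\<close> h by (cases "l = j") auto
    then show ?thesis
      by (auto simp: lies_directly_above_def plot_point_def hook_region_def h)
  qed
  have cross: "p = northeast w (H ! a) \<and> p = southwest w (H ! b) \<or>
           p = northeast w (H ! b) \<and> p = southwest w (H ! a)"
    if "a < length H" "b < length H" "a \<noteq> b"
      "p \<in> hook_region w (H ! a)" "p \<in> hook_region w (H ! b)" for a b p
  proof -
    obtain i j where ha: "H ! a = (i, j)" by (cases "H ! a")
    obtain i' j' where hb: "H ! b = (i', j')" by (cases "H ! b")
    note h = ha hb
    have m: "(i, j) \<in> set H" "(i', j') \<in> set H"
      using nth_mem[OF that(1)] nth_mem[OF that(2)] h by simp_all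
    have "i \<noteq> i'"
      using nth_eq_iff_index_eq[OF dist, of a b] that(1-3) h by simp
    then consider "i < i'" | "i' < i" by linarith
    then show ?thesis
    proof cases
      case 1
      then show ?thesis using hook_regions_meet[OF assms(1) m 1, of p] that(4,5) h by simp
    next
      case 2
      then show ?thesis using hook_regions_meet[OF assms(1) m(2,1) 2, of p] that(4,5) h by simp
    qed
  qed
  show ?thesis
    unfolding valid_hook_configuration_def
  proof (intro conjI)
    show "\<forall>h\<in>set H. is_hook w h" using hook by blast
    show "\<forall>h\<in>set H. \<forall>l<length w. \<not> lies_directly_above (plot_point w l) (hook_region w h)"
      using above by blast
    show "\<forall>a<length H. \<forall>b<length H. a \<noteq> b \<longrightarrow>
        (\<forall>p\<in>hook_region w (H ! a) \<inter> hook_region w (H ! b).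
           p = northeast w (H ! a) \<and> p = southwest w (H ! b) \<or>
           p = northeast w (H ! b) \<and> p = southwest w (H ! a))"
      by (intro allI impI ballI, rule cross) simp_all
  qed (rule assms(2))
qed

section \<open>From lists of hooks to sets of hooks\<close>

lemma VHC_conv:
  assumes "distinct w"
  shows "VHC w = Pair w ` {H. map fst H = sorted_list_of_set (descents w) \<and> hook_cfg w (set H)}"
proof -
  have "valid_hook_configuration w H \<longleftrightarrow>
      map fst H = sorted_list_of_set (descents w) \<and> hook_cfg w (set H)" for H
  proof
    assume v: "valid_hook_configuration w H"
    then have "map fst H = sorted_list_of_set (descents w)"
      by (simp add: valid_hook_configuration_def)
    then show "map fst H = sorted_list_of_set (descents w) \<and> hook_cfg w (set H)"
      using hook_cfg_of_valid[OF v assms] by blast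
  qed (use valid_of_hook_cfg in blast)
  then show ?thesis by (auto simp: VHC_def)
qed

text \<open>The order of the starting positions is prescribed and they are distinct, so a list of
  hooks loses nothing when it is replaced by its set.\<close>

lemma sorted_keys_set_inj:
  assumes "map fst H = map fst H'" "distinct (map fst H)" "set H = set H'"
  shows "H = H'"
proof (rule nth_equalityI)
  show len: "length H = length H'" using assms(1) by (metis length_map)
  fix a assume a: "a < length H"
  then have "(fst (H ! a), snd (H ! a)) \<in> set H" by simp
  moreover have "H' ! a \<in> set H" unfolding assms(3) using a len by (intro nth_mem) simp
  moreover have "fst (H ! a) = fst (H' ! a)" using assms(1) a len by (metis nth_map)
  ultimately have "snd (H ! a) = snd (H' ! a)"
    by (intro eq_key_imp_eq_value[OF assms(2), of "fst (H ! a)"]) simp_all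
  then show "H ! a = H' ! a" using \<open>fst (H ! a) = fst (H' ! a)\<close> by (rule prod_eqI[rotated])
qed

text \<open>Without open descents each descent starts exactly one hook, and listing the hooks by
  their descents in increasing order inverts the map.\<close>

lemma bij_betw_VHC_cfgs:
  assumes "distinct w"
  shows "bij_betw (\<lambda>(w, H). set H) (VHC w) (cfgs w 0)"
proof -
  let ?D = "sorted_list_of_set (descents w)"
  let ?S = "{H. map fst H = ?D \<and> hook_cfg w (set H)}"
  have inj: "inj_on set ?S"
    by (rule inj_onI) (auto intro!: sorted_keys_set_inj)
  have "cfgs w 0 = set ` ?S"
  proof (intro set_eqI iffI)
    fix F assume "F \<in> cfgs w 0"
    then have F: "hook_cfg w F" "descents w \<subseteq> fst ` F"
      by (auto simp: cfgs_def open_descents_def)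
    then have "\<forall>i\<in>descents w. \<exists>j. (i, j) \<in> F" by force
    then obtain e where e: "\<And>i. i \<in> descents w \<Longrightarrow> (i, e i) \<in> F" by metis
    define H where "H = map (\<lambda>i. (i, e i)) ?D"
    have "set H = F"
    proof (intro set_eqI iffI)
      fix p assume p: "p \<in> F"
      obtain i j where ij: "p = (i, j)" by (cases p)
      have "i \<in> descents w" using hook_cfgD(1)[OF F(1)] p ij by blast
      moreover from this have "e i = j" using hook_cfgD(6)[OF F(1)] e p ij by blast
      ultimately show "p \<in> set H" by (auto simp: H_def ij)
    next
      fix p assume "p \<in> set H"
      then show "p \<in> F" using e by (auto simp: H_def)
    qed
    moreover have "map fst H = ?D" by (simp add: H_def comp_def)
    ultimately show "F \<in> set ` ?S" using F(1) by blast
  next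
    fix F assume "F \<in> set ` ?S"
    then obtain H where H: "F = set H" "map fst H = ?D" "hook_cfg w F" by auto
    then have "fst ` F = descents w"
      by (metis finite_descents list.set_map set_sorted_list_of_set)
    then show "F \<in> cfgs w 0" using H by (simp add: cfgs_def open_descents_def)
  qed
  moreover have "inj_on (\<lambda>(w, H). set H) (VHC w)"
    unfolding VHC_conv[OF assms] using inj by (auto simp: inj_on_def)
  moreover have "(\<lambda>(w, H). set H) ` VHC w = set ` ?S"
    unfolding VHC_conv[OF assms] by (simp only: image_image prod.case)
  ultimately show ?thesis by (simp only: bij_betw_def)
qed

lemma card_VHC_set:
  assumes "finite A" "\<And>w. w \<in> A \<Longrightarrow> distinct w"
  shows "card (VHC_set A) = (\<Sum>w\<in>A. card (cfgs w 0))"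
proof -
  have bij: "bij_betw (\<lambda>(w, H). set H) (VHC w) (cfgs w 0)" if "w \<in> A" for w
    by (rule bij_betw_VHC_cfgs[OF assms(2)[OF that]])
  have "card (VHC_set A) = (\<Sum>w\<in>A. card (VHC w))"
    unfolding VHC_set_def
  proof (intro card_UN_disjoint ballI impI assms(1))
    show "finite (VHC w)" if "w \<in> A" for w using bij_betw_finite[OF bij[OF that]] by simp
    show "VHC w \<inter> VHC w' = {}" if "w \<noteq> w'" for w w' using that by (auto simp: VHC_def)
  qed
  also have "\<dots> = (\<Sum>w\<in>A. card (cfgs w 0))"
    by (intro sum.cong refl bij_betw_same_card[OF bij])
  finally show ?thesis .
qed

section \<open>Pattern avoidance\<close>

definition av231 :: "nat list \<Rightarrow> bool" where
  "av231 w \<longleftrightarrow> (\<forall>a b c. subseq [a, b, c] w \<longrightarrow> \<not> (c < a \<and> a < b))"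

definition av132 :: "nat list \<Rightarrow> bool" where
  "av132 w \<longleftrightarrow> (\<forall>a b c. subseq [a, b, c] w \<longrightarrow> \<not> (a < c \<and> c < b))"

definition av1243 :: "nat list \<Rightarrow> bool" where
  "av1243 w \<longleftrightarrow> (\<forall>a b c d. subseq [a, b, c, d] w \<longrightarrow> \<not> (a < b \<and> b < d \<and> d < c))"

lemma same_relative_order_231:
  "same_relative_order \<sigma> [2, 3, 1] \<longleftrightarrow> (\<exists>a b c. \<sigma> = [a, b, c] \<and> c < a \<and> a < b)"
proof
  assume *: "same_relative_order \<sigma> [2, 3, 1]"
  then have "length \<sigma> = 3" by (simp add: same_relative_order_def)
  then obtain a b c where \<sigma>: "\<sigma> = [a, b, c]" by (auto simp: numeral_3_eq_3 length_Suc_conv)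
  have i: "\<sigma> ! i < \<sigma> ! j \<longleftrightarrow> [2, 3, 1 :: nat] ! i < [2, 3, 1] ! j" if "i < 3" "j < 3" for i j
    using * that \<open>length \<sigma> = 3\<close> by (simp add: same_relative_order_def)
  show "\<exists>a b c. \<sigma> = [a, b, c] \<and> c < a \<and> a < b"
    \<comment> \<open>It suffices to compare neighbouring values of the pattern: 1 < 2 at positions
      2 and 0, and 2 < 3 at positions 0 and 1.\<close>
    using i[of 2 0] i[of 0 1] \<sigma> by simp
qed (auto simp: same_relative_order_def nth_Cons split: nat.splits)

lemma same_relative_order_1243:
  "same_relative_order \<sigma> [1, 2, 4, 3] \<longleftrightarrow> (\<exists>a b c d. \<sigma> = [a, b, c, d] \<and> a < b \<and> b < d \<and> d < c)"
proof
  assume *: "same_relative_order \<sigma> [1, 2, 4, 3]"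
  then have "length \<sigma> = 4" by (simp add: same_relative_order_def)
  then obtain a b c d where \<sigma>: "\<sigma> = [a, b, c, d]" by (auto simp: eval_nat_numeral length_Suc_conv)
  have i: "\<sigma> ! i < \<sigma> ! j \<longleftrightarrow> [1, 2, 4, 3 :: nat] ! i < [1, 2, 4, 3] ! j" if "i < 4" "j < 4" for i j
    using * that \<open>length \<sigma> = 4\<close> by (simp add: same_relative_order_def)
  show "\<exists>a b c d. \<sigma> = [a, b, c, d] \<and> a < b \<and> b < d \<and> d < c"
    using i[of 0 1] i[of 1 3] i[of 3 2] \<sigma> by simp
qed (auto simp: same_relative_order_def nth_Cons split: nat.splits)

definition Av231_132 :: "nat \<Rightarrow> nat list set" where
  "Av231_132 n = {w \<in> permutations_of_set {1..n}. av231 w \<and> av132 w}"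

definition Av231_1243 :: "nat \<Rightarrow> nat list set" where
  "Av231_1243 n = {w \<in> permutations_of_set {1..n}. av231 w \<and> av1243 w}"

lemma Av_eq_Av231_1243: "Av n {[2, 3, 1], [1, 2, 4, 3]} = Av231_1243 n"
proof -
  have "contains_pattern w [2, 3, 1] \<longleftrightarrow> \<not> av231 w" for w
    unfolding contains_pattern_def same_relative_order_231 av231_def by auto
  moreover have "contains_pattern w [1, 2, 4, 3] \<longleftrightarrow> \<not> av1243 w" for w
    unfolding contains_pattern_def same_relative_order_1243 av1243_def by auto
  ultimately show ?thesis by (simp add: Av_def Av231_1243_def)
qed

section \<open>Short subsequences of concatenations\<close>

lemma subseq_two_append: "subseq [a, b] (u @ v) \<longleftrightarrow>
    subseq [a, b] u \<or> a \<in> set u \<and> b \<in> set v \<or> subseq [a, b] v"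
proof -
  have "[a, b] = p @ q \<longleftrightarrow> p = [a, b] \<and> q = [] \<or> p = [a] \<and> q = [b] \<or> p = [] \<and> q = [a, b]" for p q
    by (auto simp: Cons_eq_append_conv)
  then show ?thesis
    by (simp add: subseq_append_iff conj_disj_distribR ex_disj_distrib subseq_singleton_left)
qed

lemma subseq_three_append: "subseq [a, b, c] (u @ v) \<longleftrightarrow>
    subseq [a, b, c] u \<or> subseq [a, b] u \<and> c \<in> set v \<or> a \<in> set u \<and> subseq [b, c] v \<or> subseq [a, b, c] v"
proof -
  have "[a, b, c] = p @ q \<longleftrightarrow> p = [a, b, c] \<and> q = [] \<or> p = [a, b] \<and> q = [c] \<or>
      p = [a] \<and> q = [b, c] \<or> p = [] \<and> q = [a, b, c]" for p q
    by (auto simp: Cons_eq_append_conv)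
  then show ?thesis
    by (simp add: subseq_append_iff conj_disj_distribR ex_disj_distrib subseq_singleton_left)
qed

lemma subseq_four_append: "subseq [a, b, c, d] (u @ v) \<longleftrightarrow>
    subseq [a, b, c, d] u \<or> subseq [a, b, c] u \<and> d \<in> set v \<or> subseq [a, b] u \<and> subseq [c, d] v \<or>
    a \<in> set u \<and> subseq [b, c, d] v \<or> subseq [a, b, c, d] v"
proof -
  have "[a, b, c, d] = p @ q \<longleftrightarrow> p = [a, b, c, d] \<and> q = [] \<or> p = [a, b, c] \<and> q = [d] \<or>
      p = [a, b] \<and> q = [c, d] \<or> p = [a] \<and> q = [b, c, d] \<or> p = [] \<and> q = [a, b, c, d]" for p q
    by (auto simp: Cons_eq_append_conv)
  then show ?thesis
    by (simp add: subseq_append_iff conj_disj_distribR ex_disj_distrib subseq_singleton_left)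
qed

lemma subseq_subset: "subseq xs ys \<Longrightarrow> set xs \<subseteq> set ys"
  by (induction rule: list_emb.induct) auto

lemma subseq_two_in: "subseq [a, b] w \<Longrightarrow> a \<in> set w \<and> b \<in> set w"
  using subseq_subset[of "[a, b]" w] by simp

lemma subseq_three_in: "subseq [a, b, c] w \<Longrightarrow> a \<in> set w \<and> b \<in> set w \<and> c \<in> set w"
  using subseq_subset[of "[a, b, c]" w] by simp

text \<open>Makes "decreasing" a condition on two-letter subsequences, the form in which it
  interacts with 1243.\<close>

lemma sorted_wrt_iff_subseq: "sorted_wrt R w \<longleftrightarrow> (\<forall>a b. subseq [a, b] w \<longrightarrow> R a b)"
proof (induction w)
  case (Cons x w)
  have *: "subseq [a, b] (x # w) \<longleftrightarrow> a = x \<and> b \<in> set w \<or> subseq [a, b] w" for a b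
    using subseq_two_append[of a b "[x]" w] by auto
  show ?case unfolding sorted_wrt.simps Cons * by blast
qed simp

lemma subseq_distinct: "subseq xs ys \<Longrightarrow> distinct ys \<Longrightarrow> distinct xs"
  by (auto simp: subseq_conv_nths)

section \<open>Patterns and the position of the maximum\<close>

lemma av_subseq:
  assumes "subseq v w"
  shows "av231 w \<Longrightarrow> av231 v" "av132 w \<Longrightarrow> av132 v" "av1243 w \<Longrightarrow> av1243 v"
proof -
  have "subseq xs w" if "subseq xs v" for xs using that assms by (rule subseq_order.trans)
  then show "av231 w \<Longrightarrow> av231 v" "av132 w \<Longrightarrow> av132 v" "av1243 w \<Longrightarrow> av1243 v"
    unfolding av231_def av132_def av1243_def by blast+
qed

text \<open>None of the three patterns has its largest entry last.\<close>

lemma av_snoc: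
  assumes "\<forall>x\<in>set w. x < m"
  shows "av231 (w @ [m]) \<longleftrightarrow> av231 w" "av132 (w @ [m]) \<longleftrightarrow> av132 w"
    "av1243 (w @ [m]) \<longleftrightarrow> av1243 w"
proof -
  have three: "subseq [a, b, c] w \<or> a < m \<and> b < m \<and> c = m" if "subseq [a, b, c] (w @ [m])" for a b c
    using that assms subseq_two_in[of a b w] unfolding subseq_three_append by (auto split: if_splits)
  have four: "subseq [a, b, c, d] w \<or> c < m \<and> d = m" if "subseq [a, b, c, d] (w @ [m])" for a b c d
    using that assms subseq_three_in[of a b c w] unfolding subseq_four_append by (auto split: if_splits)
  have "av231 (w @ [m])" if "av231 w"
    using that three unfolding av231_def by (metis less_asym)
  moreover have "av132 (w @ [m])" if "av132 w"
    using that three unfolding av132_def by (metis less_asym)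
  moreover have "av1243 (w @ [m])" if "av1243 w"
    using that four unfolding av1243_def by (metis less_asym)
  ultimately show "av231 (w @ [m]) \<longleftrightarrow> av231 w" "av132 (w @ [m]) \<longleftrightarrow> av132 w"
    "av1243 (w @ [m]) \<longleftrightarrow> av1243 w"
    using av_subseq[of w "w @ [m]"] by auto
qed

text \<open>None of the three patterns has its largest entry first.\<close>

lemma av_Cons:
  assumes "\<forall>x\<in>set w. x < m"
  shows "av231 (m # w) \<longleftrightarrow> av231 w" "av132 (m # w) \<longleftrightarrow> av132 w"
    "av1243 (m # w) \<longleftrightarrow> av1243 w"
proof -
  have three: "subseq [a, b, c] w \<or> a = m \<and> b < m \<and> c < m" if "subseq [a, b, c] (m # w)" for a b c
    using that assms subseq_two_in[of b c w] subseq_three_append[of a b c "[m]" w] by (auto simp: subseq_singleton_left split: if_splits)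
  have four: "subseq [a, b, c, d] w \<or> a = m \<and> b < m" if "subseq [a, b, c, d] (m # w)" for a b c d
    using that assms subseq_three_in[of b c d w] subseq_four_append[of a b c d "[m]" w] by (auto simp: subseq_singleton_left split: if_splits)
  have "av231 (m # w)" if "av231 w"
    using that three unfolding av231_def by (metis less_asym)
  moreover have "av132 (m # w)" if "av132 w"
    using that three unfolding av132_def by (metis less_asym)
  moreover have "av1243 (m # w)" if "av1243 w"
    using that four unfolding av1243_def by (metis less_asym)
  ultimately show "av231 (m # w) \<longleftrightarrow> av231 w" "av132 (m # w) \<longleftrightarrow> av132 w"
    "av1243 (m # w) \<longleftrightarrow> av1243 w"
    using av_subseq[of w "m # w"] by auto
qed

lemma subseq_append_Cons_mid:
  assumes "x \<in> set L" "r \<in> set R"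
  shows "subseq [x, m, r] (L @ m # R)"
  using assms unfolding subseq_three_append by (simp add: subseq_singleton_left)

text \<open>For \<open>x\<close> in \<open>L\<close> and \<open>r\<close> in \<open>R\<close> the
  word \<open>x m r\<close> is a 231 or a 132. Avoiding 231 forces \<open>x < r\<close>. Then an
  ascent in \<open>L\<close> extends by \<open>m r\<close> to a 1243, and a 132 in \<open>R\<close>
  preceded by \<open>x\<close> is a 1243.\<close>

lemma av_append_Cons_imp:
  assumes "distinct (L @ m # R)" "\<forall>x\<in>set L \<union> set R. x < m"
  shows "av231 (L @ m # R) \<Longrightarrow> x \<in> set L \<Longrightarrow> r \<in> set R \<Longrightarrow> x < r"
    and "av231 (L @ m # R) \<Longrightarrow> av231 R"
    and "av231 (L @ m # R) \<Longrightarrow> av132 (L @ m # R) \<Longrightarrow> L = [] \<or> R = []"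
    and "av231 (L @ m # R) \<Longrightarrow> av1243 (L @ m # R) \<Longrightarrow> L \<noteq> [] \<Longrightarrow> R \<noteq> [] \<Longrightarrow>
      sorted_wrt (>) L \<and> av132 R"
proof -
  show less: "x < r" if "av231 (L @ m # R)" "x \<in> set L" "r \<in> set R" for x r
  proof -
    have "\<not> (r < x \<and> x < m)"
      using that subseq_append_Cons_mid[OF that(2,3), of m] unfolding av231_def by blast
    moreover have "x \<noteq> r" using assms(1) that by auto
    ultimately show ?thesis using assms(2) that by auto
  qed
  show "av231 (L @ m # R) \<Longrightarrow> av231 R"
    by (rule av_subseq(1)) (auto intro: subseq_drop_many)
  show "L = [] \<or> R = []" if "av231 (L @ m # R)" "av132 (L @ m # R)"
  proof (rule ccontr)
    assume "\<not> ?thesis"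
    then obtain x r where xr: "x \<in> set L" "r \<in> set R" by (meson ex_in_conv set_empty)
    then show False
      using less[OF that(1) xr] that(2) subseq_append_Cons_mid[OF xr, of m] assms(2)
      unfolding av132_def by blast
  qed
  show "sorted_wrt (>) L \<and> av132 R"
    if "av231 (L @ m # R)" "av1243 (L @ m # R)" and ne: "L \<noteq> []" "R \<noteq> []"
  proof
    obtain x r where xr: "x \<in> set L" "r \<in> set R" using ne by (meson ex_in_conv set_empty)
    show "sorted_wrt (>) L"
      unfolding sorted_wrt_iff_subseq
    proof (intro allI impI)
      fix a b assume ab: "subseq [a, b] L"
      have "subseq [a, b, m, r] (L @ m # R)"
        unfolding subseq_four_append using ab xr by (simp add: subseq_singleton_left)
      then have "\<not> (a < b \<and> b < r \<and> r < m)" using that(2) unfolding av1243_def by blast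
      moreover have "b < r" "r < m" using less[OF that(1) _ xr(2)] subseq_two_in[OF ab] xr assms(2) by auto
      moreover have "distinct L" using assms(1) by simp
      then have "a \<noteq> b" using ab subseq_distinct by fastforce
      ultimately show "a > b" by auto
    qed
    show "av132 R"
      unfolding av132_def
    proof (intro allI impI notI)
      fix a b c assume abc: "subseq [a, b, c] R" "a < c \<and> c < b"
      have "subseq [a, b, c] (m # R)" using abc(1) by (rule list_emb_Cons)
      then have "subseq [x, a, b, c] (L @ m # R)"
        unfolding subseq_four_append using xr by blast
      moreover have "x < a" using less[OF that(1) xr(1)] subseq_three_in[OF abc(1)] by blast
      ultimately show False using that(2) abc(2) unfolding av1243_def by blast
    qed
  qed
qed

text \<open>Both patterns start with an ascent, so an occurrence has at most one letter in the
  decreasing word \<open>L\<close>. For 231 that letter would be below all later ones; for 1243 the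
  other three letters would form a 132 in \<open>m # R\<close>.\<close>

lemma av_append_Cons:
  assumes "\<forall>x\<in>set L. x < m" "\<forall>x\<in>set R. x < m" "\<forall>x\<in>set L. \<forall>y\<in>set R. x < y"
    and "sorted_wrt (>) L" "av231 R" "av132 R"
  shows "av231 (L @ m # R)" "av1243 (L @ m # R)"
proof -
  have dec: "b < a" if "subseq [a, b] L" for a b
    using assms(4) that by (simp add: sorted_wrt_iff_subseq)
  have two: "a = m \<and> b \<in> set R \<or> subseq [a, b] R" if "subseq [a, b] (m # R)" for a b
    using that subseq_two_append[of a b "[m]" R] by (auto simp: subseq_singleton_left split: if_splits)
  have three: "a = m \<and> subseq [b, c] R \<or> subseq [a, b, c] R" if "subseq [a, b, c] (m # R)" for a b c
    using that subseq_three_append[of a b c "[m]" R] by (auto simp: subseq_singleton_left split: if_splits)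
  have sub3: "subseq [a, b] w" if "subseq [a, b, c] w" for a b c :: nat and w
    using that by (rule subseq_order.trans[rotated]) simp
  have sub4: "subseq [a, b, c] w" "subseq [b, c, d] w" if "subseq [a, b, c, d] w" for a b c d :: nat and w
    using that by (rule subseq_order.trans[rotated]; simp)+
  show "av231 (L @ m # R)"
    unfolding av231_def
  proof (intro allI impI notI)
    fix a b c assume s: "subseq [a, b, c] (L @ m # R)" and o: "c < a \<and> a < b"
    have "subseq [a, b] L \<or> a \<in> set L \<and> subseq [b, c] (m # R) \<or> subseq [a, b, c] (m # R)"
      using s unfolding subseq_three_append by (elim disjE conjE) (blast dest: sub3)+
    then consider "subseq [a, b] L" | "a \<in> set L" "subseq [b, c] (m # R)" | "subseq [a, b, c] (m # R)"
      by blast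
    then show False
    proof cases
      case 1
      then show ?thesis using dec o by force
    next
      case 2
      then have "a < c" using assms(1,3) subseq_two_in[OF 2(2)] by auto
      then show ?thesis using o by simp
    next
      case 3
      show ?thesis using three[OF 3]
      proof
        assume "a = m \<and> subseq [b, c] R"
        then show False using o assms(2) subseq_two_in[of b c R] by fastforce
      next
        assume "subseq [a, b, c] R"
        then show False using o assms(5) unfolding av231_def by blast
      qed
    qed
  qed
  show "av1243 (L @ m # R)"
    unfolding av1243_def
  proof (intro allI impI notI)
    fix a b c d assume s: "subseq [a, b, c, d] (L @ m # R)" and o: "a < b \<and> b < d \<and> d < c"
    have "subseq [a, b] L \<or> subseq [b, c, d] (m # R)"
      using s unfolding subseq_four_append by (elim disjE conjE) (blast dest: sub3 sub4)+
    then consider "subseq [a, b] L" | "subseq [b, c, d] (m # R)" by blast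
    then show False
    proof cases
      case 1
      then show ?thesis using dec o by force
    next
      case 2
      show ?thesis using three[OF 2]
      proof
        assume "b = m \<and> subseq [c, d] R"
        then show False using o assms(2) subseq_two_in[of c d R] by fastforce
      next
        assume "subseq [b, c, d] R"
        then show False using o assms(6) unfolding av132_def by blast
      qed
    qed
  qed
qed

lemma subseq_map_iff: "subseq xs (map f w) \<longleftrightarrow> (\<exists>ys. xs = map f ys \<and> subseq ys w)"
proof
  assume "subseq xs (map f w)"
  then obtain N where "xs = nths (map f w) N" by (auto simp: subseq_conv_nths)
  then have "xs = map f (nths w N)" by (simp add: nths_map)
  moreover have "subseq (nths w N) w" unfolding subseq_conv_nths by blast
  ultimately show "\<exists>ys. xs = map f ys \<and> subseq ys w" by blast
next
  assume "\<exists>ys. xs = map f ys \<and> subseq ys w"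
  then show "subseq xs (map f w)" using subseq_map by blast
qed

lemma av_map_strict_mono:
  assumes "strict_mono f"
  shows "av231 (map f w) \<longleftrightarrow> av231 w" "av132 (map f w) \<longleftrightarrow> av132 w"
proof -
  have three: "subseq [a, b, c] (map f w) \<longleftrightarrow>
      (\<exists>a' b' c'. a = f a' \<and> b = f b' \<and> c = f c' \<and> subseq [a', b', c'] w)" for a b c
  proof
    assume "subseq [a, b, c] (map f w)"
    then show "\<exists>a' b' c'. a = f a' \<and> b = f b' \<and> c = f c' \<and> subseq [a', b', c'] w"
      unfolding subseq_map_iff by (auto simp: Cons_eq_map_conv)
  next
    assume "\<exists>a' b' c'. a = f a' \<and> b = f b' \<and> c = f c' \<and> subseq [a', b', c'] w"
    then obtain a' b' c' where "a = f a'" "b = f b'" "c = f c'" "subseq [a', b', c'] w" by blast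
    then show "subseq [a, b, c] (map f w)" using subseq_map[of "[a', b', c']" w f] by simp
  qed
  show "av231 (map f w) \<longleftrightarrow> av231 w" "av132 (map f w) \<longleftrightarrow> av132 w"
    unfolding av231_def av132_def three
    by (metis strict_mono_less[OF assms])+
qed

section \<open>Decomposition of both classes at the maximum\<close>

lemma finite_Avs [simp]: "finite (Av231_132 n)" "finite (Av231_1243 n)"
  by (simp_all add: Av231_132_def Av231_1243_def)

lemma insert_max_permutation:
  "w @ [Suc p] \<in> permutations_of_set {1..Suc p} \<longleftrightarrow> w \<in> permutations_of_set {1..p}"
  "Suc p # w \<in> permutations_of_set {1..Suc p} \<longleftrightarrow> w \<in> permutations_of_set {1..p}"
proof -
  have "insert (Suc p) (set w) = {1..Suc p} \<and> Suc p \<notin> set w \<longleftrightarrow> set w = {1..p}"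
    using insert_ident[of "Suc p" "set w" "{1..p}"] by (auto simp: atLeastAtMostSuc_conv)
  then show "w @ [Suc p] \<in> permutations_of_set {1..Suc p} \<longleftrightarrow> w \<in> permutations_of_set {1..p}"
    "Suc p # w \<in> permutations_of_set {1..Suc p} \<longleftrightarrow> w \<in> permutations_of_set {1..p}"
    unfolding permutations_of_set_def by auto
qed

lemma permutation_less_Suc: "w \<in> permutations_of_set {1..p} \<Longrightarrow> \<forall>x\<in>set w. x < Suc p"
  by (auto simp: permutations_of_set_def)

lemma permutation_split_max:
  assumes "w \<in> permutations_of_set {1..Suc p}"
  obtains L R where "w = L @ Suc p # R" "distinct (L @ Suc p # R)" "set L \<union> set R = {1..p}"
    "\<forall>x\<in>set L \<union> set R. x < Suc p"
proof -
  have w: "set w = {1..Suc p}" "distinct w" using assms by (auto simp: permutations_of_set_def)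
  then have "Suc p \<in> set w" by simp
  then obtain L R where LR: "w = L @ Suc p # R" using split_list[of "Suc p" w] by blast
  then have d: "distinct (L @ Suc p # R)" using w by simp
  have "insert (Suc p) (set L \<union> set R) = {1..Suc p}" using w(1) unfolding LR by simp
  moreover have "Suc p \<notin> set L \<union> set R" using d by simp
  ultimately have u: "set L \<union> set R = {1..p}"
    using insert_ident[of "Suc p" "set L \<union> set R" "{1..p}"] by (simp add: atLeastAtMostSuc_conv)
  then have "\<forall>x\<in>set L \<union> set R. x < Suc p" by simp
  then show thesis by (rule that[OF LR d u])
qed

lemma insert_max_in_Avs:
  "w @ [Suc p] \<in> Av231_132 (Suc p) \<longleftrightarrow> w \<in> Av231_132 p"
  "w @ [Suc p] \<in> Av231_1243 (Suc p) \<longleftrightarrow> w \<in> Av231_1243 p"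
  "Suc p # w \<in> Av231_132 (Suc p) \<longleftrightarrow> w \<in> Av231_132 p"
  "Suc p # w \<in> Av231_1243 (Suc p) \<longleftrightarrow> w \<in> Av231_1243 p"
  unfolding Av231_132_def Av231_1243_def mem_Collect_eq insert_max_permutation
  using av_snoc[OF permutation_less_Suc] av_Cons[OF permutation_less_Suc] by blast+

text \<open>For \<open>p = 0\<close> the two images coincide, which is why the counting below
  assumes \<open>0 < p\<close>.\<close>

lemma Av231_132_Suc:
  "Av231_132 (Suc p) = (\<lambda>w. w @ [Suc p]) ` Av231_132 p \<union> (#) (Suc p) ` Av231_132 p"
proof (intro set_eqI iffI)
  fix w assume w: "w \<in> Av231_132 (Suc p)"
  then have perm: "w \<in> permutations_of_set {1..Suc p}" and av: "av231 w" "av132 w"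
    by (auto simp: Av231_132_def)
  obtain L R where LR: "w = L @ Suc p # R" "distinct (L @ Suc p # R)"
    "\<forall>x\<in>set L \<union> set R. x < Suc p" using permutation_split_max[OF perm] by metis
  have "L = [] \<or> R = []" using av_append_Cons_imp(3)[OF LR(2,3)] av LR(1) by blast
  then show "w \<in> (\<lambda>w. w @ [Suc p]) ` Av231_132 p \<union> (#) (Suc p) ` Av231_132 p"
    using w LR(1) insert_max_in_Avs(1)[of L p] insert_max_in_Avs(3)[of p R] by auto
qed (auto simp: insert_max_in_Avs)

text \<open>The prefix ending at the maximum, for a permutation of the second class whose maximum is
  in the middle with \<open>k\<close> letters before it.\<close>

definition dec_max :: "nat \<Rightarrow> nat \<Rightarrow> nat list" where
  "dec_max k p = rev [1..<Suc k] @ [Suc p]"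

lemma decreasing_unique:
  assumes "sorted_wrt (>) L" "set L = {1..k}"
  shows "L = rev [1..<Suc k]"
proof -
  have "sorted_wrt (<) (rev L)" using assms(1) by (simp add: sorted_wrt_rev)
  moreover have "set (rev L) = set [1..<Suc k]" using assms(2) by (auto simp: atLeastLessThanSuc_atLeastAtMost simp del: upt_Suc)
  ultimately have "rev L = [1..<Suc k]"
    by (intro strict_sorted_equal) (auto simp del: upt_Suc)
  then show ?thesis by (metis rev_rev_ident)
qed

text \<open>Turns the separation of values at the maximum into intervals: the cut \<open>k\<close>
  is the largest element of \<open>A\<close>, and it is below \<open>p\<close> because
  \<open>B\<close> is nonempty.\<close>

lemma separated_intervals:
  fixes A B :: "nat set"
  assumes "A \<union> B = {1..p}" "\<forall>x\<in>A. \<forall>y\<in>B. x < y" "A \<noteq> {}" "B \<noteq> {}"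
  obtains k where "1 \<le> k" "k < p" "A = {1..k}" "B = {Suc k..p}"
proof -
  have fin: "finite A" "finite B" using assms(1) by (metis finite_Un finite_atLeastAtMost)+
  define k where "k = Max A"
  have k: "k \<in> A" "\<And>x. x \<in> A \<Longrightarrow> x \<le> k" using fin assms(3) by (auto simp: k_def)
  obtain y where y: "y \<in> B" using assms(4) by blast
  have "k < y" using assms(2) k(1) y by blast
  moreover have "y \<le> p" "1 \<le> k" using assms(1) k(1) y by auto
  moreover have A: "A = {1..k}"
  proof (intro set_eqI iffI)
    fix x assume "x \<in> A"
    then show "x \<in> {1..k}" using k(2) assms(1) by auto
  next
    fix x assume x: "x \<in> {1..k}"
    then have "x \<in> A \<union> B" using \<open>k < y\<close> \<open>y \<le> p\<close> unfolding assms(1) by auto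
    moreover have "x \<notin> B" using x assms(2) k(1) by force
    ultimately show "x \<in> A" by blast
  qed
  moreover have "B = {Suc k..p}"
  proof (intro set_eqI iffI)
    fix x assume "x \<in> B"
    then have "k < x" "x \<in> {1..p}" using assms(1,2) k(1) by auto
    then show "x \<in> {Suc k..p}" by auto
  next
    fix x assume x: "x \<in> {Suc k..p}"
    then have "x \<in> A \<union> B" unfolding assms(1) by auto
    then show "x \<in> B" using x A by auto
  qed
  ultimately show thesis by (intro that[of k]) auto
qed

lemma dec_max_append_in_Av:
  assumes "1 \<le> k" "k < p" "R \<in> Av231_132 (p - k)"
  shows "dec_max k p @ map ((+) k) R \<in> Av231_1243 (Suc p)"
proof -
  have R: "set R = {1..p - k}" "distinct R" "av231 R" "av132 R"
    using assms(3) by (auto simp: Av231_132_def permutations_of_set_def)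
  have sR: "set (map ((+) k) R) = {Suc k..p}"
    using assms(2) by (simp add: R(1) image_add_atLeastAtMost)
  have sL: "set (rev [1..<Suc k]) = {1..k}" by auto
  have mono: "strict_mono ((+) k)" by (simp add: strict_mono_def)
  have dec: "sorted_wrt (>) (rev [1..<Suc k])" by (simp add: sorted_wrt_rev del: upt_Suc)
  have "av231 (rev [1..<Suc k] @ Suc p # map ((+) k) R) \<and> av1243 (rev [1..<Suc k] @ Suc p # map ((+) k) R)"
    by (intro conjI av_append_Cons)
      (use sL sR R assms dec in \<open>auto simp: av_map_strict_mono[OF mono] simp del: upt_Suc\<close>)
  moreover have "distinct (rev [1..<Suc k] @ Suc p # map ((+) k) R)"
    using R(2) assms(2) sR by (auto simp: distinct_map simp del: upt_Suc)
  moreover have "set (rev [1..<Suc k] @ Suc p # map ((+) k) R) = {1..Suc p}"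
    unfolding set_append list.set sL sR using assms by auto
  ultimately show ?thesis
    by (simp add: Av231_1243_def permutations_of_set_def dec_max_def del: upt_Suc)
qed

text \<open>The three sets are: maximum last, maximum first, maximum in the middle. In the last one
  \<open>1 \<le> k\<close> and \<open>k < p\<close> say that both sides are nonempty.\<close>

lemma Av231_1243_Suc:
  "Av231_1243 (Suc p) = (\<lambda>w. w @ [Suc p]) ` Av231_1243 p \<union> (#) (Suc p) ` Av231_1243 p \<union>
    (\<Union>k\<in>{1..<p}. (\<lambda>R. dec_max k p @ map ((+) k) R) ` Av231_132 (p - k))"
    (is "_ = ?A \<union> ?B \<union> ?C")
proof (intro set_eqI iffI)
  fix w assume w: "w \<in> Av231_1243 (Suc p)"
  then have perm: "w \<in> permutations_of_set {1..Suc p}" and av: "av231 w" "av1243 w"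
    by (auto simp: Av231_1243_def)
  obtain L R where LR: "w = L @ Suc p # R" "distinct (L @ Suc p # R)" "set L \<union> set R = {1..p}"
    "\<forall>x\<in>set L \<union> set R. x < Suc p" using permutation_split_max[OF perm] by metis
  note imp = av_append_Cons_imp[OF LR(2,4), folded LR(1)]
  consider "R = []" | "L = []" | "L \<noteq> []" "R \<noteq> []" by blast
  then show "w \<in> ?A \<union> ?B \<union> ?C"
  proof cases
    case 1
    then show ?thesis using w LR(1) insert_max_in_Avs(2)[of L p] by auto
  next
    case 2
    then show ?thesis using w LR(1) insert_max_in_Avs(4)[of p R] by auto
  next
    case 3
    obtain k where k: "1 \<le> k" "k < p" "set L = {1..k}" "set R = {Suc k..p}"
      using separated_intervals[OF LR(3)] imp(1)[OF av(1)] 3 by (metis set_empty)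
    have L: "L = rev [1..<Suc k]" using decreasing_unique imp(4)[OF av 3] k(3) by blast
    \<comment> \<open>Standardisation: the values of \<open>R\<close> are \<open>Suc k\<close> to
      \<open>p\<close>, so subtracting \<open>k\<close> gives a permutation of
      \<open>{1..p - k}\<close>.\<close>
    define R' where "R' = map (\<lambda>x. x - k) R"
    have R: "R = map ((+) k) R'"
      unfolding R'_def map_map using k(4) by (intro map_idI[symmetric]) auto
    have mono: "strict_mono ((+) k)" by (simp add: strict_mono_def)
    have "av231 R'" "av132 R'"
      using imp(2)[OF av(1)] imp(4)[OF av 3] av_map_strict_mono[OF mono] R by auto
    moreover have "distinct R'" using LR(2) R by (auto simp: distinct_map)
    moreover have "(+) k ` set R' = (+) k ` {1..p - k}"
      using k R by (simp add: image_add_atLeastAtMost flip: set_map)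
    then have "set R' = {1..p - k}" by (subst (asm) inj_image_eq_iff) auto
    ultimately have "R' \<in> Av231_132 (p - k)"
      by (simp add: Av231_132_def permutations_of_set_def)
    then have "w \<in> (\<lambda>R. dec_max k p @ map ((+) k) R) ` Av231_132 (p - k)"
      using LR(1) L R by (intro image_eqI[of _ _ R']) (auto simp: dec_max_def)
    then show ?thesis using k by auto
  qed
qed (auto simp: insert_max_in_Avs intro: dec_max_append_in_Av)

section \<open>Generating functions\<close>

text \<open>The factor \<open>fps_X\<close> expresses coefficient n + 1 of each series by
  coefficients n of its neighbours, so all vanish by induction. It is applied to differences between
  a series and its claimed value.\<close>

lemma fps_system_unique:
  fixes E :: "nat \<Rightarrow> 'a :: comm_ring_1 fps"
  assumes "\<And>t. E t = fps_X * (E t + E (Suc t) + (if t = 0 then 0 else E (t - 1)))"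
  shows "E t = 0"
proof -
  have "\<forall>t. E t $ n = 0" for n
  proof (induction n)
    case 0
    show ?case by (subst assms) simp
  next
    case (Suc n)
    have "E t $ Suc n = (fps_X * (E t + E (Suc t) + (if t = 0 then 0 else E (t - 1)))) $ Suc n" for t
      by (subst assms) (rule refl)
    then show ?case using Suc by simp
  qed
  then show ?thesis by (simp add: fps_eq_iff)
qed

text \<open>The quadratic formula for x u^2 - (1 - x) u + x = 0, whose discriminant is 1 - 2x -
  3x^2. The series \<open>u\<close> is x times the Motzkin series.\<close>

lemma kernel_root_exists:
  defines "s \<equiv> fps_radical root 2 (1 - 2 * fps_X - 3 * fps_X ^ 2 :: real fps)"
  obtains u :: "real fps" where "u = fps_X * (1 + u + u\<^sup>2)" "s = 1 - fps_X - 2 * fps_X * u"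
proof -
  let ?r = "1 - 2 * fps_X - 3 * fps_X ^ 2 :: real fps"
  have r0: "?r $ 0 = 1" by simp
  have s2: "s ^ 2 = ?r"
    using power_radical[of ?r root 1] r0 by (simp add: s_def numeral_2_eq_2)
  have s0: "s $ 0 = 1" using r0 by (simp add: s_def)
  \<comment> \<open>The shift divides by x; this is exact because \<open>1 - fps_X - s\<close> has
    constant term 0.\<close>
  define u where "u = fps_const (1 / 2) * fps_shift 1 (1 - fps_X - s)"
  have "fps_X * fps_shift 1 (1 - fps_X - s) = 1 - fps_X - s"
    using s0 by (intro fps_ext) (auto simp: fps_X_mult_nth split: nat.splits)
  then have "fps_const 2 * (fps_X * u) = fps_const (2 * (1 / 2)) * (1 - fps_X - s)"
    unfolding u_def by (metis (no_types, lifting) fps_const_mult mult.assoc mult.left_commute)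
  then have s: "s = 1 - fps_X - 2 * fps_X * u"
    by (simp add: fps_numeral_fps_const algebra_simps)
  have "(2 * fps_X) ^ 2 * (fps_X * (1 + u + u\<^sup>2) - u) = fps_X * (s ^ 2 - ?r)"
    unfolding s by algebra
  then have "(2 * fps_X) ^ 2 * (fps_X * (1 + u + u\<^sup>2) - u) = 0" by (simp add: s2)
  then have "u = fps_X * (1 + u + u\<^sup>2)" by auto
  then show ?thesis using that s by blast
qed

text \<open>Here \<open>d\<close> and \<open>b\<close> are the numbers of configurations by size and
  open descents in the classes avoiding 231 and 132, respectively 231 and 1243. The double sum in
  \<open>bS\<close> counts the permutations with the maximum in the middle.\<close>

lemma generating_function:
  fixes b d :: "nat \<Rightarrow> nat \<Rightarrow> nat"
  assumes d1: "\<And>t. d 1 t = (if t = 0 then 1 else 0)"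
    and d0: "\<And>p. 0 < p \<Longrightarrow> d (Suc p) 0 = d p 0 + d p 1"
    and dS: "\<And>p t. 0 < p \<Longrightarrow> d (Suc p) (Suc t) = d p (Suc t) + d p (Suc (Suc t)) + d p t"
    and b1: "\<And>t. b 1 t = (if t = 0 then 1 else 0)"
    and b0: "\<And>p. 0 < p \<Longrightarrow> b (Suc p) 0 = b p 0 + b p 1"
    and bS: "\<And>p t. 0 < p \<Longrightarrow> b (Suc p) (Suc t) = b p (Suc t) + b p (Suc (Suc t)) + b p t +
      (\<Sum>k\<in>{1..<p}. \<Sum>i\<le>t. ((if Suc i = k then 1 else 0) + (if Suc (Suc i) = k then 1 else 0)) * d (p - k) (t - i))"
  shows "Abs_fps (\<lambda>n. if n = 0 then 1 else real (b n 0)) =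
    1 + 2 * fps_X ^ 2 / (3 * fps_X - 1 + fps_radical root 2 (1 - 2 * fps_X - 3 * fps_X ^ 2))"
proof -
  obtain u :: "real fps" where u: "u = fps_X * (1 + u + u\<^sup>2)"
    and s: "fps_radical root 2 (1 - 2 * fps_X - 3 * fps_X ^ 2) = 1 - fps_X - 2 * fps_X * u"
    using kernel_root_exists by blast
  \<comment> \<open>Coefficient 0 is set to 0 in \<open>D\<close> and \<open>B\<close>: the empty
    permutation is left out and returns as the summand 1 at the end.\<close>
  define D where "D t = Abs_fps (\<lambda>n. if n = 0 then 0 else real (d n t))" for t
  define B where "B t = Abs_fps (\<lambda>n. if n = 0 then 0 else real (b n t))" for t
  have D_rec: "D t = (if t = 0 then fps_X else 0) +
      fps_X * (D t + D (Suc t) + (if t = 0 then 0 else D (t - 1)))" for t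
  proof (rule fps_ext)
    fix n
    consider "n = 0" | "n = 1" | p where "n = Suc p" "p > 0" by (cases n) auto
    then show "D t $ n = ((if t = 0 then fps_X else 0) +
      fps_X * (D t + D (Suc t) + (if t = 0 then 0 else D (t - 1)))) $ n"
    proof cases
      case 2
      then show ?thesis using d1 by (simp add: D_def)
    next
      case 3
      then show ?thesis using d0[of p] dS[of p "t - 1"] by (cases t) (auto simp: D_def)
    qed (simp add: D_def)
  qed
  have D: "D t = u ^ Suc t" for t
  proof -
    have "D t - u ^ Suc t = 0" for t
    proof (rule fps_system_unique[where E = "\<lambda>t. D t - u ^ Suc t"])
      fix t
      \<comment> \<open>The powers of \<open>u\<close> solve the same recursion: multiply the
        equation for \<open>u\<close> by \<open>u ^ t\<close>.\<close>
      have U: "u ^ Suc t = (if t = 0 then fps_X else 0) +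
        fps_X * (u ^ Suc t + u ^ Suc (Suc t) + (if t = 0 then 0 else u ^ Suc (t - 1)))"
      proof (cases t)
        case 0
        then show ?thesis using u by (simp add: algebra_simps power2_eq_square)
      next
        case (Suc k)
        have "u ^ Suc t = u ^ Suc k * u" by (simp add: Suc)
        also have "\<dots> = u ^ Suc k * (fps_X * (1 + u + u\<^sup>2))" using u by simp
        finally show ?thesis by (simp add: Suc algebra_simps power2_eq_square)
      qed
      note arg_cong2[where f = "(-)", OF D_rec[of t] U]
      also have "(if t = 0 then fps_X else 0) + fps_X * (D t + D (Suc t) + (if t = 0 then 0 else D (t - 1)))
          - ((if t = 0 then fps_X else 0) +
            fps_X * (u ^ Suc t + u ^ Suc (Suc t) + (if t = 0 then 0 else u ^ Suc (t - 1))))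
        = fps_X * (D t - u ^ Suc t + (D (Suc t) - u ^ Suc (Suc t)) +
            (if t = 0 then 0 else D (t - 1) - u ^ Suc (t - 1)))"
        by (simp add: algebra_simps)
      finally show "D t - u ^ Suc t = fps_X * (D t - u ^ Suc t + (D (Suc t) - u ^ Suc (Suc t)) +
        (if t = 0 then 0 else D (t - 1) - u ^ Suc (t - 1)))" .
    qed
    then show ?thesis by simp
  qed
  \<comment> \<open>Contribution of a maximum in the middle: its prefix has \<open>i\<close> open
    descents and, with the maximum, length \<open>i + 2\<close> or \<open>i + 3\<close>. The maximum
    is one more open descent, which leaves \<open>t - 1 - i\<close> for the right part.\<close>
  define S where "S t = (\<Sum>i<t. (fps_X ^ (i + 2) + fps_X ^ (i + 3)) * D (t - 1 - i))" for t
  have S_nth: "S (Suc t) $ Suc p = real (\<Sum>k\<in>{1..<p}. \<Sum>i\<le>t.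
      ((if Suc i = k then 1 else 0) + (if Suc (Suc i) = k then 1 else 0)) * d (p - k) (t - i))" for t p
  proof -
    have "(\<Sum>k\<in>{1..<p}. \<Sum>i\<le>t.
        ((if Suc i = k then 1 else 0) + (if Suc (Suc i) = k then 1 else 0)) * d (p - k) (t - i))
      = (\<Sum>i\<le>t. \<Sum>k\<in>{1..<p}. (if k = Suc i then d (p - k) (t - i) else 0) +
          (if k = Suc (Suc i) then d (p - k) (t - i) else 0))"
      by (subst sum.swap) (intro sum.cong refl, auto)
    \<comment> \<open>Each \<open>i\<close> selects at most one \<open>k\<close> per summand. The
      remaining conditions say that the right part is nonempty, matching the zero constant term of
      \<open>D\<close>.\<close>
    also have "\<dots> = (\<Sum>i\<le>t. (if Suc i < p then d (p - Suc i) (t - i) else 0) +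
          (if Suc (Suc i) < p then d (p - Suc (Suc i)) (t - i) else 0))"
      by (simp add: sum.distrib)
    finally show ?thesis
      by (auto simp: S_def fps_sum_nth distrib_right fps_X_power_mult_nth D_def lessThan_Suc_atMost
          simp del: power_Suc intro!: sum.cong)
  qed
  have B_rec: "B t = (if t = 0 then fps_X else 0) +
      fps_X * (B t + B (Suc t) + (if t = 0 then 0 else B (t - 1))) + S t" for t
  proof (rule fps_ext)
    fix n
    consider "n = 0" | "n = 1" | p where "n = Suc p" "p > 0" by (cases n) auto
    then show "B t $ n = ((if t = 0 then fps_X else 0) +
      fps_X * (B t + B (Suc t) + (if t = 0 then 0 else B (t - 1))) + S t) $ n"
    proof cases
      case 1
      then show ?thesis by (simp add: B_def S_def fps_sum_nth fps_mult_nth_0)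
    next
      case 2
      then show ?thesis using b1 S_nth[of "t - 1" 0] by (cases t) (simp_all add: B_def S_def)
    next
      case 3
      show ?thesis
      proof (cases t)
        case 0
        then show ?thesis using 3 b0[of p] by (simp add: B_def S_def)
      next
        case (Suc s)
        then show ?thesis using 3 bS[of p s] S_nth[of s p] by (simp add: B_def)
      qed
    qed
  qed
  \<comment> \<open>A geometric sum in x and \<open>u\<close>: its denominator is u - x = x u (1 +
    u), by the equation for \<open>u\<close>. The induction avoids this division.\<close>
  have S: "(1 + u) * S t = fps_X * (1 + fps_X) * (u ^ t - fps_X ^ t)" for t
  proof (induction t)
    case 0
    show ?case by (simp add: S_def)
  next
    case (Suc t)
    have "S (Suc t) = (\<Sum>i<t. (fps_X ^ (i + 2) + fps_X ^ (i + 3)) * D (t - i))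
        + (fps_X ^ (t + 2) + fps_X ^ (t + 3)) * u"
      by (simp add: S_def D)
    also have "(\<Sum>i<t. (fps_X ^ (i + 2) + fps_X ^ (i + 3)) * D (t - i)) = u * S t"
      unfolding S_def sum_distrib_left
    proof (intro sum.cong refl)
      fix i assume "i \<in> {..<t}"
      then have "t - i = Suc (t - 1 - i)" by auto
      then have "D (t - i) = u * D (t - 1 - i)" by (simp only: D power_Suc)
      then show "(fps_X ^ (i + 2) + fps_X ^ (i + 3)) * D (t - i) =
        u * ((fps_X ^ (i + 2) + fps_X ^ (i + 3)) * D (t - 1 - i))" by (simp add: algebra_simps)
    qed
    finally have "(1 + u) * S (Suc t) = u * ((1 + u) * S t) +
        (1 + u) * u * (fps_X ^ (t + 2) + fps_X ^ (t + 3))" by (simp add: algebra_simps)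
    also have "\<dots> = u * (fps_X * (1 + fps_X) * (u ^ t - fps_X ^ t)) +
        (1 + u) * u * (fps_X ^ (t + 2) + fps_X ^ (t + 3))" by (simp add: Suc)
    also have "\<dots> = fps_X * (1 + fps_X) * (u * u ^ t + fps_X ^ t * (fps_X * (1 + u + u\<^sup>2) - fps_X - u))"
      by (simp add: power_add algebra_simps power2_eq_square power3_eq_cube)
    also have "fps_X * (1 + u + u\<^sup>2) - fps_X - u = - fps_X" using u by simp
    finally show ?case by (simp add: algebra_simps)
  qed
  \<comment> \<open>The claimed value of \<open>(1 - u) * (1 + u) * B t\<close>. The factor
    \<open>Suc t\<close> arises because the term \<open>u ^ t\<close> in \<open>S t\<close> itself
    solves the homogeneous recursion.\<close>
  define C where "C t = of_nat (Suc t) * fps_X * (1 + u) * u ^ t - (1 - u) * (u ^ t - fps_X ^ t)" for t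
  have C_rec: "C t = (if t = 0 then (1 - u) * (1 + u) * fps_X else 0) +
      fps_X * (C t + C (Suc t) + (if t = 0 then 0 else C (t - 1))) +
      (1 - u) * (fps_X * (1 + fps_X) * (u ^ t - fps_X ^ t))" for t
  proof (cases t)
    case 0
    have "C 0 - ((1 - u) * (1 + u) * fps_X + fps_X * (C 0 + C 1)) =
        2 * fps_X * (u - fps_X * (1 + u + u\<^sup>2))"
      by (simp add: C_def algebra_simps power2_eq_square)
    then have "C 0 = (1 - u) * (1 + u) * fps_X + fps_X * (C 0 + C 1)" using u by simp
    then show ?thesis by (simp add: 0)
  next
    case (Suc k)
    \<comment> \<open>With the powers and \<open>of_nat k\<close> abstracted, a polynomial identity
      remains. Its right side contains the factor u - x (1 + u + u^2), which is 0.\<close>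
    define p q where "p = u ^ k" and "q = (fps_X ^ k :: real fps)"
    define c where "c = (of_nat k :: real fps)"
    have "C (Suc k) - (fps_X * (C (Suc k) + C (Suc (Suc k)) + C k) +
        (1 - u) * (fps_X * (1 + fps_X) * (u ^ Suc k - fps_X ^ Suc k))) =
      (u - fps_X * (1 + u + u\<^sup>2)) * p * (fps_X * (1 + u) * (c + 2) - (1 - u) * (1 + fps_X))"
      by (simp add: C_def flip: p_def q_def c_def) algebra
    then show ?thesis using u Suc by simp
  qed
  have BC: "(1 - u) * (1 + u) * B t = C t" for t
  proof -
    have "(1 - u) * (1 + u) * B t - C t = 0" for t
    \<comment> \<open>The initial terms and the terms from \<open>S\<close> cancel in the
      difference, leaving the homogeneous system.\<close>
    proof (rule fps_system_unique[where E = "\<lambda>t. (1 - u) * (1 + u) * B t - C t"])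
      fix t
      have "(1 - u) * (1 + u) * B t = (1 - u) * (1 + u) * ((if t = 0 then fps_X else 0) +
        fps_X * (B t + B (Suc t) + (if t = 0 then 0 else B (t - 1)))) + (1 - u) * ((1 + u) * S t)"
        by (subst B_rec) (simp add: algebra_simps)
      then have "(1 - u) * (1 + u) * B t - C t = ((1 - u) * (1 + u) * ((if t = 0 then fps_X else 0) +
        fps_X * (B t + B (Suc t) + (if t = 0 then 0 else B (t - 1)))) + (1 - u) * ((1 + u) * S t)) -
        ((if t = 0 then (1 - u) * (1 + u) * fps_X else 0) +
        fps_X * (C t + C (Suc t) + (if t = 0 then 0 else C (t - 1))) +
        (1 - u) * (fps_X * (1 + fps_X) * (u ^ t - fps_X ^ t)))"
        using C_rec[of t] by (rule arg_cong2)
      also have "\<dots> = (1 - u) * (1 + u) * (fps_X * (B t + B (Suc t) + (if t = 0 then 0 else B (t - 1)))) -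
          fps_X * (C t + C (Suc t) + (if t = 0 then 0 else C (t - 1)))"
        unfolding S by (simp add: algebra_simps)
      also have "\<dots> = fps_X * ((1 - u) * (1 + u) * B t - C t +
        ((1 - u) * (1 + u) * B (Suc t) - C (Suc t)) +
        (if t = 0 then 0 else (1 - u) * (1 + u) * B (t - 1) - C (t - 1)))"
        by (simp add: algebra_simps)
      finally show "(1 - u) * (1 + u) * B t - C t = fps_X * ((1 - u) * (1 + u) * B t - C t +
        ((1 - u) * (1 + u) * B (Suc t) - C (Suc t)) +
        (if t = 0 then 0 else (1 - u) * (1 + u) * B (t - 1) - C (t - 1)))" .
    qed
    then show ?thesis by simp
  qed
  have u0: "u $ 0 = 0" by (subst u) simp
  have nz: "1 + u \<noteq> 0" "1 - u \<noteq> 0" using u0 by (auto simp: fps_eq_iff dest: spec[of _ 0])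
  have "(1 + u) * ((1 - u) * B 0) = (1 + u) * fps_X" using BC[of 0] by (simp add: C_def algebra_simps)
  then have B0: "(1 - u) * B 0 = fps_X" using nz by (metis mult_cancel_left)
  \<comment> \<open>The denominator of the claim becomes 2x (1 - u), so the quotient is x / (1 - u),
    which is \<open>B 0\<close>.\<close>
  have "3 * fps_X - 1 + fps_radical root 2 (1 - 2 * fps_X - 3 * fps_X ^ 2) = 2 * fps_X * (1 - u)"
    unfolding s by (simp add: algebra_simps)
  moreover have "2 * fps_X ^ 2 = (2 * fps_X * (1 - u)) * B 0"
    using B0 by (simp add: power2_eq_square mult.assoc)
  moreover have "2 * fps_X * (1 - u) \<noteq> 0" using nz by simp
  ultimately have "2 * fps_X ^ 2 / (3 * fps_X - 1 + fps_radical root 2 (1 - 2 * fps_X - 3 * fps_X ^ 2)) = B 0"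
    by (metis nonzero_mult_div_cancel_left)
  moreover have "Abs_fps (\<lambda>n. if n = 0 then 1 else real (b n 0)) = 1 + B 0"
    by (rule fps_ext) (simp add: B_def)
  ultimately show ?thesis by simp
qed

section \<open>Counting configurations\<close>

text \<open>The decreasing part has its \<open>k - 1\<close> descents open; the final maximum closes
  none of them or the rightmost one.\<close>

lemma card_cfgs_dec_max:
  assumes "1 \<le> k" "k \<le> p"
  shows "card (cfgs (dec_max k p) i) = (if Suc i = k then 1 else 0) + (if Suc (Suc i) = k then 1 else 0)"
proof -
  have "sorted_wrt (>) (rev [1..<Suc k])" by (simp add: sorted_wrt_rev del: upt_Suc)
  moreover have "rev [1..<Suc k] \<noteq> []" using assms by simp
  ultimately have "card (cfgs (rev [1..<Suc k]) t) = (if Suc t = k then 1 else 0)" for t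
    using card_cfgs_decreasing[of "rev [1..<Suc k]" t] by simp
  moreover have "\<forall>x\<in>set (rev [1..<Suc k]). x < Suc p" using assms by auto
  ultimately show ?thesis
    unfolding dec_max_def by (subst card_cfgs_snoc) (simp_all del: upt_Suc)
qed

lemma card_cfgs_dec_max_append:
  assumes "1 \<le> k" "k < p" "R \<in> Av231_132 (p - k)"
  shows "card (cfgs (dec_max k p @ map ((+) k) R) 0) = 0"
    and "card (cfgs (dec_max k p @ map ((+) k) R) (Suc t)) =
      (\<Sum>i\<le>t. ((if Suc i = k then 1 else 0) + (if Suc (Suc i) = k then 1 else 0)) * card (cfgs R (t - i)))"
proof -
  have "set R = {1..p - k}"
    using assms(3) by (auto simp: Av231_132_def permutations_of_set_def)
  then have R: "map ((+) k) R \<noteq> []" "\<forall>x\<in>set (map ((+) k) R). x < Suc p"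
    using assms(2) by auto
  have u: "dec_max k p \<noteq> []" "last (dec_max k p) = Suc p" "\<forall>x\<in>set (butlast (dec_max k p)). x < Suc p"
    using assms(2) by (auto simp: dec_max_def)
  have mono: "strict_mono ((+) k)" by (simp add: strict_mono_def)
  have *: "\<forall>x\<in>set (butlast (dec_max k p)) \<union> set (map ((+) k) R). x < last (dec_max k p)"
    using R u by auto
  show "card (cfgs (dec_max k p @ map ((+) k) R) 0) = 0"
    by (rule card_cfgs_append(1)[OF u(1) R(1) *])
  show "card (cfgs (dec_max k p @ map ((+) k) R) (Suc t)) =
      (\<Sum>i\<le>t. ((if Suc i = k then 1 else 0) + (if Suc (Suc i) = k then 1 else 0)) * card (cfgs R (t - i)))"
    unfolding card_cfgs_append(2)[OF u(1) R(1) *] cfgs_map_strict_mono[OF mono]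
    using assms by (simp add: card_cfgs_dec_max)
qed

lemma permutation_of_pos_nonempty: "w \<in> permutations_of_set {1..p :: nat} \<Longrightarrow> 0 < p \<Longrightarrow> w \<noteq> []"
  using length_finite_permutations_of_set[of w "{1..p}"] by auto

section \<open>Recursions for the weights of the two classes\<close>

lemma Avs_permutation:
  "w \<in> Av231_132 n \<Longrightarrow> w \<in> permutations_of_set {1..n}"
  "w \<in> Av231_1243 n \<Longrightarrow> w \<in> permutations_of_set {1..n}"
  by (simp_all add: Av231_132_def Av231_1243_def)

text \<open>For the two classes at size n > 0 these are the coefficients of the generating functions
  with \<open>t\<close> open descents.\<close>

definition weight :: "nat list set \<Rightarrow> nat \<Rightarrow> nat" where
  "weight A t = (\<Sum>w\<in>A. card (cfgs w t))"

lemma weight_snoc: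
  assumes "A \<subseteq> permutations_of_set {1..p}"
  shows "weight ((\<lambda>w. w @ [Suc p]) ` A) t = weight A t + weight A (Suc t)"
proof -
  have "weight ((\<lambda>w. w @ [Suc p]) ` A) t = (\<Sum>w\<in>A. card (cfgs (w @ [Suc p]) t))"
    unfolding weight_def by (subst sum.reindex) (auto simp: inj_on_def)
  also have "\<dots> = (\<Sum>w\<in>A. card (cfgs w t) + card (cfgs w (Suc t)))"
    using assms permutation_less_Suc by (intro sum.cong refl card_cfgs_snoc) blast
  finally show ?thesis by (simp add: weight_def sum.distrib)
qed

lemma weight_Cons:
  assumes "A \<subseteq> permutations_of_set {1..p}" "0 < p"
  shows "weight ((#) (Suc p) ` A) 0 = 0" "weight ((#) (Suc p) ` A) (Suc t) = weight A t"
proof -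
  have re: "weight ((#) (Suc p) ` A) t = (\<Sum>w\<in>A. card (cfgs (Suc p # w) t))" for t
    unfolding weight_def by (subst sum.reindex) auto
  have A: "w \<noteq> []" "\<forall>x\<in>set w. x < Suc p" if "w \<in> A" for w
    using assms that permutation_less_Suc permutation_of_pos_nonempty by blast+
  show "weight ((#) (Suc p) ` A) 0 = 0"
    unfolding re using card_cfgs_Cons_max(1)[OF A] by simp
  show "weight ((#) (Suc p) ` A) (Suc t) = weight A t"
    unfolding re unfolding weight_def by (intro sum.cong refl card_cfgs_Cons_max(2)[OF A])
qed

lemma weight_Un: "finite A \<Longrightarrow> finite B \<Longrightarrow> A \<inter> B = {} \<Longrightarrow> weight (A \<union> B) t = weight A t + weight B t"
  unfolding weight_def by (rule sum.union_disjoint)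

lemma snoc_Cons_disjoint:
  assumes "A \<subseteq> permutations_of_set {1..p}" "B \<subseteq> permutations_of_set {1..p}" "0 < p"
  shows "(\<lambda>w. w @ [Suc p]) ` A \<inter> (#) (Suc p) ` B = {}"
proof (rule ccontr)
  assume "\<not> ?thesis"
  then obtain v w where *: "v \<in> A" "w \<in> B" "v @ [Suc p] = Suc p # w" by blast
  moreover have "v \<noteq> []" using * assms permutation_of_pos_nonempty by blast
  ultimately have "Suc p \<in> set v" by (metis hd_append2 hd_in_set list.sel(1))
  moreover have "\<forall>x\<in>set v. x < Suc p" using * assms permutation_less_Suc by blast
  ultimately show False by blast
qed

text \<open>The first occurrence of the maximum \<open>Suc p\<close> determines the cut, which
  \<open>takeWhile\<close> finds on both sides.\<close>

lemma dec_max_append_split: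
  assumes "dec_max k p @ u = L @ Suc p # R" "Suc p \<notin> set L" "k \<le> p" "1 \<le> k"
  shows "L = rev [1..<Suc k]" "u = R"
proof -
  let ?t = "takeWhile (\<lambda>y. y \<noteq> Suc p)"
  have eq: "rev [1..<Suc k] @ Suc p # u = L @ Suc p # R" using assms(1) by (simp add: dec_max_def)
  have "?t (rev [1..<Suc k] @ Suc p # u) = rev [1..<Suc k]"
    using assms(3) by (subst takeWhile_append2) auto
  moreover have "?t (L @ Suc p # R) = L" using assms(2) by (subst takeWhile_append2) auto
  ultimately show "L = rev [1..<Suc k]" using eq by simp
  then show "u = R" using eq by simp
qed

lemma weight_Av231_132:
  assumes "0 < p"
  shows "weight (Av231_132 (Suc p)) 0 = weight (Av231_132 p) 0 + weight (Av231_132 p) 1"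
    and "weight (Av231_132 (Suc p)) (Suc t) =
      weight (Av231_132 p) (Suc t) + weight (Av231_132 p) (Suc (Suc t)) + weight (Av231_132 p) t"
proof -
  have A: "Av231_132 p \<subseteq> permutations_of_set {1..p}" using Avs_permutation by blast
  note disj = snoc_Cons_disjoint[OF A A assms]
  show "weight (Av231_132 (Suc p)) 0 = weight (Av231_132 p) 0 + weight (Av231_132 p) 1"
    "weight (Av231_132 (Suc p)) (Suc t) =
      weight (Av231_132 p) (Suc t) + weight (Av231_132 p) (Suc (Suc t)) + weight (Av231_132 p) t"
    unfolding Av231_132_Suc
    by (subst weight_Un; simp add: disj weight_snoc[OF A] weight_Cons[OF A assms])+
qed

text \<open>The sets of \<open>Av231_1243_Suc\<close> are disjoint, since the position of the
  maximum tells them apart. A maximum in the middle is an open descent, so it contributes nothing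
  for zero open descents.\<close>

lemma weight_Av231_1243:
  assumes "0 < p"
  shows "weight (Av231_1243 (Suc p)) 0 = weight (Av231_1243 p) 0 + weight (Av231_1243 p) 1"
    and "weight (Av231_1243 (Suc p)) (Suc t) =
      weight (Av231_1243 p) (Suc t) + weight (Av231_1243 p) (Suc (Suc t)) + weight (Av231_1243 p) t +
      (\<Sum>k\<in>{1..<p}. \<Sum>i\<le>t. ((if Suc i = k then 1 else 0) + (if Suc (Suc i) = k then 1 else 0)) *
        weight (Av231_132 (p - k)) (t - i))"
proof -
  let ?U = "\<lambda>k. (\<lambda>R. dec_max k p @ map ((+) k) R) ` Av231_132 (p - k)"
  let ?S = "(\<lambda>w. w @ [Suc p]) ` Av231_1243 p" and ?T = "(#) (Suc p) ` Av231_1243 p"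
  have A: "Av231_1243 p \<subseteq> permutations_of_set {1..p}" using Avs_permutation by blast
  have max_notin: "Suc p \<notin> set w" if "w \<in> Av231_1243 p" for w
    using permutation_less_Suc A that by blast
  have disj: "?S \<inter> ?T = {}" by (rule snoc_Cons_disjoint[OF A A assms])
  have disjU: "(?S \<union> ?T) \<inter> (\<Union>k\<in>{1..<p}. ?U k) = {}"
  proof (rule ccontr)
    assume "\<not> ?thesis"
    then obtain v k where v: "v \<in> ?S \<union> ?T" and kv: "k \<in> {1..<p}" "v \<in> ?U k" by blast
    from kv obtain R where R: "R \<in> Av231_132 (p - k)" and v': "v = dec_max k p @ map ((+) k) R"
      by blast
    from v obtain w where w: "w \<in> Av231_1243 p" and "v = w @ [Suc p] \<or> v = Suc p # w" by blast
    then have eq: "dec_max k p @ map ((+) k) R = w @ [Suc p] \<or> dec_max k p @ map ((+) k) R = Suc p # w"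
      unfolding v' by simp
    have k: "1 \<le> k" "k < p" using kv(1) by auto
    have "R \<noteq> []" using permutation_of_pos_nonempty[OF Avs_permutation(1)[OF R]] k by simp
    \<comment> \<open>Maximum last would make the right part empty, maximum first would make the
      decreasing part empty.\<close>
    then show False
      using eq dec_max_append_split[of k p "map ((+) k) R" w "[]"] max_notin[OF w]
        dec_max_append_split[of k p "map ((+) k) R" "[]" w] k by auto
  qed
  have U_disj: "?U k \<inter> ?U l = {}" if "k \<in> {1..<p}" "l \<in> {1..<p}" "k \<noteq> l" for k l
  proof (rule ccontr)
    assume "\<not> ?thesis"
    then obtain Q R where "dec_max k p @ map ((+) k) Q = dec_max l p @ map ((+) l) R" by blast
    then have "rev [1..<Suc l] = rev [1..<Suc k]"
      using dec_max_append_split(1)[of k p "map ((+) k) Q" "rev [1..<Suc l]" "map ((+) l) R"] that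
      by (auto simp: dec_max_def)
    then have "length (rev [1..<Suc l]) = length (rev [1..<Suc k])" by simp
    then show False using that(3) by (simp del: upt_Suc)
  qed
  have W: "weight (Av231_1243 (Suc p)) t = weight ?S t + weight ?T t + (\<Sum>k\<in>{1..<p}. weight (?U k) t)" for t
  proof -
    have "weight (\<Union>k\<in>{1..<p}. ?U k) t = (\<Sum>k\<in>{1..<p}. weight (?U k) t)"
      unfolding weight_def using U_disj by (intro sum.UNION_disjoint) auto
    moreover have "weight (?S \<union> ?T \<union> (\<Union>k\<in>{1..<p}. ?U k)) t =
        weight (?S \<union> ?T) t + weight (\<Union>k\<in>{1..<p}. ?U k) t"
      by (rule weight_Un[OF _ _ disjU]) simp_all
    moreover have "weight (?S \<union> ?T) t = weight ?S t + weight ?T t"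
      by (rule weight_Un[OF _ _ disj]) simp_all
    ultimately show ?thesis unfolding Av231_1243_Suc by (simp only:)
  qed
  have U: "weight (?U k) t = (\<Sum>R\<in>Av231_132 (p - k). card (cfgs (dec_max k p @ map ((+) k) R) t))" for k t
    unfolding weight_def by (subst sum.reindex) (auto simp: inj_on_def)
  have "weight (?U k) 0 = 0" if "k \<in> {1..<p}" for k
    unfolding U using that card_cfgs_dec_max_append(1) by simp
  then show "weight (Av231_1243 (Suc p)) 0 = weight (Av231_1243 p) 0 + weight (Av231_1243 p) 1"
    unfolding W by (simp add: weight_snoc[OF A] weight_Cons[OF A assms])
  have "weight (?U k) (Suc t) = (\<Sum>i\<le>t. ((if Suc i = k then 1 else 0) + (if Suc (Suc i) = k then 1 else 0)) *
        weight (Av231_132 (p - k)) (t - i))" if "k \<in> {1..<p}" for k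
  proof -
    have "weight (?U k) (Suc t) = (\<Sum>R\<in>Av231_132 (p - k). \<Sum>i\<le>t.
        ((if Suc i = k then 1 else 0) + (if Suc (Suc i) = k then 1 else 0)) * card (cfgs R (t - i)))"
      unfolding U using that card_cfgs_dec_max_append(2) by (intro sum.cong refl) auto
    also have "\<dots> = (\<Sum>i\<le>t. \<Sum>R\<in>Av231_132 (p - k).
        ((if Suc i = k then 1 else 0) + (if Suc (Suc i) = k then 1 else 0)) * card (cfgs R (t - i)))"
      by (rule sum.swap)
    finally show ?thesis by (simp only: weight_def sum_distrib_left)
  qed
  then show "weight (Av231_1243 (Suc p)) (Suc t) =
      weight (Av231_1243 p) (Suc t) + weight (Av231_1243 p) (Suc (Suc t)) + weight (Av231_1243 p) t +
      (\<Sum>k\<in>{1..<p}. \<Sum>i\<le>t. ((if Suc i = k then 1 else 0) + (if Suc (Suc i) = k then 1 else 0)) *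
        weight (Av231_132 (p - k)) (t - i))"
    unfolding W by (simp add: weight_snoc[OF A] weight_Cons[OF A assms])
qed

lemma weight_short:
  assumes "n \<le> 1"
  shows "weight (Av231_132 n) t = (if t = 0 then 1 else 0)"
    "weight (Av231_1243 n) t = (if t = 0 then 1 else 0)"
proof -
  define w where "w = [1..<Suc n]"
  have len: "length w \<le> 1" using assms by (simp add: w_def)
  then have "av231 w" "av132 w" "av1243 w" by (simp_all add: av231_def av132_def av1243_def)
  moreover have "permutations_of_set {1..n} = {w}"
    using assms by (cases n) (auto simp: w_def)
  ultimately have "Av231_132 n = {w}" "Av231_1243 n = {w}"
    by (auto simp: Av231_132_def Av231_1243_def)
  then show "weight (Av231_132 n) t = (if t = 0 then 1 else 0)"
    "weight (Av231_1243 n) t = (if t = 0 then 1 else 0)"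
    using len by (simp_all add: weight_def cfgs_short)
qed

theorem theorem7:
  shows "Abs_fps (\<lambda>n. real (card (VHC_set (Av n {[2, 3, 1], [1, 2, 4, 3]})))) =
    1 + 2 * fps_X ^ 2 /
      (3 * fps_X - 1 + fps_radical root 2 (1 - 2 * fps_X - 3 * fps_X ^ 2))"
proof -
  have "card (VHC_set (Av n {[2, 3, 1], [1, 2, 4, 3]})) = weight (Av231_1243 n) 0" for n
    unfolding Av_eq_Av231_1243 weight_def
    by (rule card_VHC_set) (simp, use Avs_permutation(2) in \<open>auto simp: permutations_of_set_def\<close>)
  \<comment> \<open>The empty permutation gives the constant coefficient 1; the recursions govern
    the positive sizes.\<close>
  then have "Abs_fps (\<lambda>n. real (card (VHC_set (Av n {[2, 3, 1], [1, 2, 4, 3]})))) =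
      Abs_fps (\<lambda>n. if n = 0 then 1 else real (weight (Av231_1243 n) 0))"
    by (intro fps_ext) (auto simp: weight_short)
  also have "\<dots> = 1 + 2 * fps_X ^ 2 /
      (3 * fps_X - 1 + fps_radical root 2 (1 - 2 * fps_X - 3 * fps_X ^ 2))"
    by (rule generating_function[where d = "\<lambda>n. weight (Av231_132 n)"])
      (simp_all only: weight_short weight_Av231_132 weight_Av231_1243 order_refl)
  finally show ?thesis .
qed

end
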